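(* Let $\Lambda_2=\mathbb{C}\langle x,y\rangle/(yx-xy-y^2)$ be the Jordanian plane over $\mathbb{C}$. Then the Arens-Michael envelope of $\Lambda_2$ is (topologically isomorphic, via the map sending $x\mapsto x$, $y\mapsto y$, to) $$\widehat{\Lambda}_2=\Big\{a=\sum_{i,j=0}^\infty a_{ij}x^iy^j\ :\ \|a\|_\rho=\sum_{i,j=0}^\infty|a_{ij}|\frac{\rho^{i+j}}{j!}<\infty\ \text{ for every }\rho>0\Big\},$$ with the topology given by the family of seminorms $\{\|\cdot\|_\rho:\rho>0\}$ and with the (continuous) multiplication determined by the relation $yx=xy+y^2$, i.e. extending the multiplication of $\Lambda_2$ on the dense subspace of finite sums.
   Context: An Arens-Michael algebra is a complete locally convex topological algebra (over $\mathbb{C}$, associative, unital) whose topology is defined by a family of submultiplicative seminorms ($\|ab\|\le\|a\|\|b\|$). For an algebra $A$ without topology, endow $A$ with the strongest locally convex topology; its Arens-Michael envelope is a pair $(\widehat A,\iota_A)$ consisting of an Arens-Michael algebra $\widehat A$ and a continuous homomorphism $\iota_A:A\to\widehat A$ such that for every Arens-Michael algebra $B$ and every continuous homomorphism $\varphi:A\to B$ there is a unique continuous homomorphism $\widehat\varphi:\widehat A\to B$ with $\widehat\varphi\circ\iota_A=\varphi$. (Equivalently, $\widehat A$ is the Hausdorff completion of $A$ with respect to all submultiplicative seminorms.) The monomials $x^iy^j$ ($i,j\ge0$) form a basis of $\Lambda_2$. *)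

theory Defs
  imports "HOL-Analysis.Analysis"
begin

text \<open>An element of Lambda_2 (or of its completion) is represented by its coefficient
  family (a_ij), where (i,j) indexes the monomial x^i y^j.\<close>

type_synonym coef = "nat \<times> nat \<Rightarrow> complex"

definition finsupp :: "coef \<Rightarrow> bool" where
  "finsupp f \<longleftrightarrow> finite {p. f p \<noteq> 0}"

definition cadd :: "coef \<Rightarrow> coef \<Rightarrow> coef" where
  "cadd f g = (\<lambda>p. f p + g p)"

definition cscale :: "complex \<Rightarrow> coef \<Rightarrow> coef" where
  "cscale c f = (\<lambda>p. c * f p)"

definition mono :: "nat \<Rightarrow> nat \<Rightarrow> coef" where
  "mono i j = (\<lambda>p. if p = (i, j) then 1 else 0)"

text \<open>Right multiplication by x: (x^a y^b) x = x^(a+1) y^b + b x^a y^(b+1),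
  which follows from y x = x y + y^2 (indeed y^b x = (x + b y) y^b).\<close>
definition Rx :: "coef \<Rightarrow> coef" where
  "Rx f = (\<lambda>(a, b). (if 0 < a then f (a - 1, b) else 0)
                  + (if 0 < b then of_nat (b - 1) * f (a, b - 1) else 0))"

definition Ry :: "coef \<Rightarrow> coef" where
  "Ry f = (\<lambda>(a, b). if 0 < b then f (a, b - 1) else 0)"

text \<open>Multiplication of Lambda_2 = C<x,y>/(yx - xy - y^2) on finitely supported
  coefficient families: f * g = sum_(k,l) g_kl f x^k y^l.\<close>
definition jmult :: "coef \<Rightarrow> coef \<Rightarrow> coef" where
  "jmult f g = (\<lambda>p. \<Sum>q\<in>{q. g q \<noteq> 0}. g q * ((Ry ^^ snd q) ((Rx ^^ fst q) f)) p)"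

definition rterm :: "real \<Rightarrow> coef \<Rightarrow> nat \<times> nat \<Rightarrow> real" where
  "rterm \<rho> a = (\<lambda>(i, j). norm (a (i, j)) * \<rho> ^ (i + j) / fact j)"

definition rnorm :: "real \<Rightarrow> coef \<Rightarrow> real" where
  "rnorm \<rho> a = infsum (rterm \<rho> a) UNIV"

definition Ehat :: "coef set" where
  "Ehat = {a. \<forall>\<rho>>0. rterm \<rho> a summable_on UNIV}"

definition emult :: "coef \<Rightarrow> coef \<Rightarrow> coef" where
  "emult a b = (\<lambda>p. infsum (\<lambda>(q, r). a q * b r * jmult (mono (fst q) (snd q)) (mono (fst r) (snd r)) p) UNIV)"

definition Ehat_is_AM_algebra :: bool where
  "Ehat_is_AM_algebra \<longleftrightarrow>
     \<comment> \<open>linear subspace, containing the unit, closed under multiplication\<close>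
     mono 0 0 \<in> Ehat
   \<and> (\<forall>a\<in>Ehat. \<forall>b\<in>Ehat. cadd a b \<in> Ehat \<and> emult a b \<in> Ehat)
   \<and> (\<forall>c. \<forall>a\<in>Ehat. cscale c a \<in> Ehat)
     \<comment> \<open>associative unital bilinear multiplication\<close>
   \<and> (\<forall>a\<in>Ehat. \<forall>b\<in>Ehat. \<forall>c\<in>Ehat. emult (emult a b) c = emult a (emult b c))
   \<and> (\<forall>a\<in>Ehat. emult (mono 0 0) a = a \<and> emult a (mono 0 0) = a)
   \<and> (\<forall>a\<in>Ehat. \<forall>b\<in>Ehat. \<forall>c\<in>Ehat.
        emult (cadd a b) c = cadd (emult a c) (emult b c)
      \<and> emult c (cadd a b) = cadd (emult c a) (emult c b))
   \<and> (\<forall>s. \<forall>a\<in>Ehat. \<forall>b\<in>Ehat.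
        emult (cscale s a) b = cscale s (emult a b) \<and> emult a (cscale s b) = cscale s (emult a b))
     \<comment> \<open>the topology of the rho-norms is given by submultiplicative seminorms\<close>
   \<and> (\<exists>N :: (coef \<Rightarrow> real) set.
        (\<forall>q\<in>N. (\<forall>a\<in>Ehat. 0 \<le> q a)
              \<and> (\<forall>a\<in>Ehat. \<forall>b\<in>Ehat. q (cadd a b) \<le> q a + q b)
              \<and> (\<forall>c. \<forall>a\<in>Ehat. q (cscale c a) = norm c * q a)
              \<and> (\<forall>a\<in>Ehat. \<forall>b\<in>Ehat. q (emult a b) \<le> q a * q b)
              \<and> (\<exists>\<rho>>0. \<exists>C. \<forall>a\<in>Ehat. q a \<le> C * rnorm \<rho> a))
      \<and> (\<forall>\<rho>>0. \<exists>q\<in>N. \<exists>C. \<forall>a\<in>Ehat. rnorm \<rho> a \<le> C * q a))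
     \<comment> \<open>completeness (the space is metrizable, so sequences suffice)\<close>
   \<and> (\<forall>s :: nat \<Rightarrow> coef. (\<forall>n. s n \<in> Ehat) \<longrightarrow>
        (\<forall>\<rho>>0. \<forall>\<epsilon>>0. \<exists>M. \<forall>m\<ge>M. \<forall>n\<ge>M. rnorm \<rho> (cadd (s m) (cscale (-1) (s n))) < \<epsilon>) \<longrightarrow>
        (\<exists>L\<in>Ehat. \<forall>\<rho>>0. (\<lambda>n. rnorm \<rho> (cadd (s n) (cscale (-1) L))) \<longlonglongrightarrow> 0))"

definition cplx_alg :: "(complex \<Rightarrow> 'b::ring_1 \<Rightarrow> 'b) \<Rightarrow> bool" where
  "cplx_alg sc \<longleftrightarrow>
     (\<forall>c a b. sc c (a + b) = sc c a + sc c b)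
   \<and> (\<forall>c d a. sc (c + d) a = sc c a + sc d a)
   \<and> (\<forall>c d a. sc (c * d) a = sc c (sc d a))
   \<and> (\<forall>a. sc 1 a = a)
   \<and> (\<forall>c a b. sc c (a * b) = sc c a * b \<and> sc c (a * b) = a * sc c b)"

definition submult_seminorm :: "(complex \<Rightarrow> 'b::ring_1 \<Rightarrow> 'b) \<Rightarrow> ('b \<Rightarrow> real) \<Rightarrow> bool" where
  "submult_seminorm sc p \<longleftrightarrow>
     (\<forall>a. 0 \<le> p a)
   \<and> (\<forall>a b. p (a + b) \<le> p a + p b)
   \<and> (\<forall>c a. p (sc c a) = norm c * p a)
   \<and> (\<forall>a b. p (a * b) \<le> p a * p b)"

definition AM_algebra :: "(complex \<Rightarrow> 'b::ring_1 \<Rightarrow> 'b) \<Rightarrow> ('b \<Rightarrow> real) set \<Rightarrow> bool" where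
  "AM_algebra sc N \<longleftrightarrow>
     cplx_alg sc
   \<and> (\<forall>p\<in>N. submult_seminorm sc p)
   \<and> (\<forall>a. a \<noteq> 0 \<longrightarrow> (\<exists>p\<in>N. p a \<noteq> 0))
   \<and> (\<forall>F. F \<noteq> bot \<longrightarrow>
        (\<forall>p\<in>N. \<forall>\<epsilon>>0. eventually (\<lambda>(a, b). p (a - b) < \<epsilon>) (F \<times>\<^sub>F F)) \<longrightarrow>
        (\<exists>L. \<forall>p\<in>N. \<forall>\<epsilon>>0. eventually (\<lambda>a. p (a - L) < \<epsilon>) F))"

text \<open>Unital algebra homomorphisms Lambda_2 -> B (continuity w.r.t. the strongest
  locally convex topology is automatic for linear maps).\<close>
definition lam_hom :: "(complex \<Rightarrow> 'b::ring_1 \<Rightarrow> 'b) \<Rightarrow> (coef \<Rightarrow> 'b) \<Rightarrow> bool" where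
  "lam_hom sc \<phi> \<longleftrightarrow>
     (\<forall>f g. finsupp f \<and> finsupp g \<longrightarrow> \<phi> (cadd f g) = \<phi> f + \<phi> g)
   \<and> (\<forall>c f. finsupp f \<longrightarrow> \<phi> (cscale c f) = sc c (\<phi> f))
   \<and> (\<forall>f g. finsupp f \<and> finsupp g \<longrightarrow> \<phi> (jmult f g) = \<phi> f * \<phi> g)
   \<and> \<phi> (mono 0 0) = 1"

definition ehat_hom :: "(complex \<Rightarrow> 'b::ring_1 \<Rightarrow> 'b) \<Rightarrow> ('b \<Rightarrow> real) set \<Rightarrow> (coef \<Rightarrow> 'b) \<Rightarrow> bool" where
  "ehat_hom sc N \<psi> \<longleftrightarrow>
     (\<forall>a\<in>Ehat. \<forall>b\<in>Ehat. \<psi> (cadd a b) = \<psi> a + \<psi> b)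
   \<and> (\<forall>c. \<forall>a\<in>Ehat. \<psi> (cscale c a) = sc c (\<psi> a))
   \<and> (\<forall>a\<in>Ehat. \<forall>b\<in>Ehat. \<psi> (emult a b) = \<psi> a * \<psi> b)
   \<and> \<psi> (mono 0 0) = 1
   \<and> (\<forall>q\<in>N. \<exists>\<rho>>0. \<exists>C. \<forall>a\<in>Ehat. q (\<psi> a) \<le> C * rnorm \<rho> a)"

end

theory Submission
  imports Defs
begin

text \<open>The product preserves the total degree, so each coefficient of \<open>emult a b\<close> is a finite sum and
  the algebra identities hold for arbitrary formal series. In the weighted \<open>\<ell>\<^sup>1\<close> norm \<open>rnorm \<rho>\<close>, right
  multiplication by \<open>x\<close> has norm at most \<open>2\<rho>\<close> and right multiplication by \<open>y^l\<close> at most \<open>\<rho>^l / l!\<close>;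
  hence \<open>rnorm \<rho> (ab) \<le> rnorm \<rho> a * rnorm (2\<rho>) b\<close>, and the operator norms of right multiplications
  are submultiplicative and define the same topology.

  In an Arens-Michael algebra with elements \<open>X, Y\<close> satisfying \<open>YX = XY + Y\<^sup>2\<close> one has
  \<open>Y\<^sup>n X - X Y\<^sup>n = n Y\<^sup>n\<^sup>+\<^sup>1\<close>. A submultiplicative seminorm \<open>q\<close> therefore satisfies
  \<open>n q(Y\<^sup>n\<^sup>+\<^sup>1) \<le> 2 q(X) q(Y\<^sup>n)\<close>, which forces the decay \<open>q(X\<^sup>i Y\<^sup>j) \<le> K \<rho>^(i+j) / j!\<close>. So every
  homomorphism from the Jordanian plane is continuous for the norms \<open>rnorm \<rho>\<close> and extends by density.\<close>

section \<open>Grading by total degree, truncation and finite support\<close>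

definition deg :: "nat \<times> nat \<Rightarrow> nat" where
  "deg p = fst p + snd p"

text \<open>The finite index sets behind all products: the coefficient at \<open>p\<close> only
  involves factors with indices in \<open>tri (deg p)\<close>.\<close>

definition tri :: "nat \<Rightarrow> (nat \<times> nat) set" where
  "tri n = {p. deg p \<le> n}"

definition trunc :: "nat \<Rightarrow> coef \<Rightarrow> coef" where
  "trunc n a = (\<lambda>p. if p \<in> tri n then a p else 0)"

text \<open>Right multiplication by \<open>x^k y^l\<close> for \<open>r = (k, l)\<close>; the powers
  of x act before those of y, as in \<open>jmult\<close>.\<close>

definition ract :: "nat \<times> nat \<Rightarrow> coef \<Rightarrow> coef" where
  "ract r f = (Ry ^^ snd r) ((Rx ^^ fst r) f)"

lemma finite_tri [simp]: "finite (tri n)"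
proof (rule finite_subset)
  show "tri n \<subseteq> {..n} \<times> {..n}" by (auto simp: tri_def deg_def)
qed auto

lemma tri_mono: "m \<le> n \<Longrightarrow> tri m \<subseteq> tri n"
  by (auto simp: tri_def)

lemma finsupp_trunc [simp]: "finsupp (trunc n a)"
  unfolding finsupp_def by (rule finite_subset[of _ "tri n"]) (auto simp: trunc_def)

lemma finsupp_mono [simp]: "finsupp (mono i j)"
  unfolding finsupp_def by (rule finite_subset[of _ "{(i, j)}"]) (auto simp: mono_def)

lemma finsupp_cadd [simp]: "finsupp f \<Longrightarrow> finsupp g \<Longrightarrow> finsupp (cadd f g)"
  unfolding finsupp_def
  by (rule finite_subset[of _ "{p. f p \<noteq> 0} \<union> {p. g p \<noteq> 0}"]) (auto simp: cadd_def)

lemma finsupp_cscale [simp]: "finsupp f \<Longrightarrow> finsupp (cscale c f)"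
  unfolding finsupp_def
  by (rule finite_subset[of _ "{p. f p \<noteq> 0}"]) (auto simp: cscale_def)

subsection \<open>The right action of monomials\<close>

lemma Rx_lincomb: "Rx (\<lambda>p. \<Sum>i\<in>S. c i * f i p) = (\<lambda>p. \<Sum>i\<in>S. c i * Rx (f i) p)"
proof
  fix p :: "nat \<times> nat"
  obtain a b where p: "p = (a, b)" by (cases p)
  show "Rx (\<lambda>p. \<Sum>i\<in>S. c i * f i p) p = (\<Sum>i\<in>S. c i * Rx (f i) p)"
    by (auto simp: p Rx_def sum.distrib sum_distrib_left algebra_simps)
qed

lemma Ry_lincomb: "Ry (\<lambda>p. \<Sum>i\<in>S. c i * f i p) = (\<lambda>p. \<Sum>i\<in>S. c i * Ry (f i) p)"
  by (auto simp: Ry_def fun_eq_iff)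

lemma Rx_pow_lincomb:
  "(Rx ^^ k) (\<lambda>p. \<Sum>i\<in>S. c i * f i p) = (\<lambda>p. \<Sum>i\<in>S. c i * (Rx ^^ k) (f i) p)"
  by (induction k) (simp_all add: Rx_lincomb)

lemma Ry_pow_lincomb:
  "(Ry ^^ k) (\<lambda>p. \<Sum>i\<in>S. c i * f i p) = (\<lambda>p. \<Sum>i\<in>S. c i * (Ry ^^ k) (f i) p)"
  by (induction k) (simp_all add: Ry_lincomb)

lemma ract_lincomb:
  "ract r (\<lambda>p. \<Sum>i\<in>S. c i * f i p) = (\<lambda>p. \<Sum>i\<in>S. c i * ract r (f i) p)"
  by (simp add: ract_def Rx_pow_lincomb Ry_pow_lincomb)

text \<open>Both terms of \<open>(x^a y^b) x\<close> have degree \<open>a + b + 1\<close>, so the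
  lowest degree present rises by one.\<close>

lemma Rx_vanish: "(\<And>p. deg p < n \<Longrightarrow> f p = 0) \<Longrightarrow> deg p < Suc n \<Longrightarrow> Rx f p = 0"
  by (cases p) (auto simp: Rx_def deg_def)

lemma Ry_vanish: "(\<And>p. deg p < n \<Longrightarrow> f p = 0) \<Longrightarrow> deg p < Suc n \<Longrightarrow> Ry f p = 0"
  by (cases p) (auto simp: Ry_def deg_def)

lemma Rx_pow_vanish: "deg p < k \<Longrightarrow> (Rx ^^ k) f p = 0"
proof (induction k arbitrary: p)
  case (Suc k)
  then show ?case using Rx_vanish[of k "(Rx ^^ k) f"] by simp
qed simp

lemma Ry_pow_vanish:
  "(\<And>p. deg p < n \<Longrightarrow> f p = 0) \<Longrightarrow> deg p < n + l \<Longrightarrow> (Ry ^^ l) f p = 0"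
proof (induction l arbitrary: p)
  case (Suc l)
  then show ?case using Ry_vanish[of "n + l" "(Ry ^^ l) f"] by simp
qed simp

text \<open>A monomial raises degrees by its own degree. This makes sums over right factors finite
  at each coefficient.\<close>

lemma ract_vanish: "deg p < deg r \<Longrightarrow> ract r f p = 0"
  unfolding ract_def
  by (rule Ry_pow_vanish[where n = "fst r"]) (auto simp: deg_def intro: Rx_pow_vanish[unfolded deg_def])

text \<open>A coefficient of \<open>Rx f\<close> is read off from coefficients of \<open>f\<close>
  of smaller degree, so a series may be replaced by any other that agrees with it up to degree
  \<open>n\<close>.\<close>

lemma Rx_local: "(\<And>p. deg p \<le> n \<Longrightarrow> f p = g p) \<Longrightarrow> deg p \<le> n \<Longrightarrow> Rx f p = Rx g p"
  by (cases p) (auto simp: Rx_def deg_def)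

lemma Ry_local: "(\<And>p. deg p \<le> n \<Longrightarrow> f p = g p) \<Longrightarrow> deg p \<le> n \<Longrightarrow> Ry f p = Ry g p"
  by (cases p) (auto simp: Ry_def deg_def)

lemma Rx_pow_local:
  "(\<And>p. deg p \<le> n \<Longrightarrow> f p = g p) \<Longrightarrow> deg p \<le> n \<Longrightarrow> (Rx ^^ k) f p = (Rx ^^ k) g p"
proof (induction k arbitrary: p)
  case (Suc k)
  then show ?case by (auto intro!: Rx_local[where n = n])
qed auto

lemma Ry_pow_local:
  "(\<And>p. deg p \<le> n \<Longrightarrow> f p = g p) \<Longrightarrow> deg p \<le> n \<Longrightarrow> (Ry ^^ k) f p = (Ry ^^ k) g p"
proof (induction k arbitrary: p)
  case (Suc k)
  then show ?case by (auto intro!: Ry_local[where n = n])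
qed auto

lemma ract_local:
  "(\<And>p. deg p \<le> n \<Longrightarrow> f p = g p) \<Longrightarrow> deg p \<le> n \<Longrightarrow> ract r f p = ract r g p"
  unfolding ract_def by (rule Ry_pow_local[where n = n]) (auto intro: Rx_pow_local[where n = n])

text \<open>By locality \<open>f\<close> may be replaced by its finite part on \<open>S\<close>, and
  linearity then splits this part into monomials.\<close>

lemma ract_eq_sum_mono:
  assumes "finite S" "tri (deg p) \<subseteq> S"
  shows "ract r f p = (\<Sum>q\<in>S. f q * ract r (mono (fst q) (snd q)) p)"
proof -
  have "(\<Sum>q\<in>S. f q * mono (fst q) (snd q) p') = f p'" if "deg p' \<le> deg p" for p'
  proof -
    have "(\<Sum>q\<in>S. f q * mono (fst q) (snd q) p') = (\<Sum>q\<in>S. if q = p' then f q else 0)"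
      by (rule sum.cong) (auto simp: mono_def)
    moreover have "p' \<in> S" using that assms by (auto simp: tri_def)
    ultimately show ?thesis using assms(1) by simp
  qed
  then have "ract r f p = ract r (\<lambda>p'. \<Sum>q\<in>S. f q * mono (fst q) (snd q) p') p"
    by (intro ract_local[where n = "deg p"]) auto
  then show ?thesis by (simp add: ract_lincomb)
qed

text \<open>The relation \<open>yx = xy + y^2\<close> for operators. They act on the right, so
  \<open>Rx (Ry f)\<close> is \<open>f y x\<close>.\<close>

lemma Rx_Ry: "Rx (Ry f) = cadd (Ry (Rx f)) (Ry (Ry f))"
proof
  fix p :: "nat \<times> nat"
  obtain a b where p: "p = (a, b)" by (cases p)
  show "Rx (Ry f) p = cadd (Ry (Rx f)) (Ry (Ry f)) p"
  proof (cases b)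
    case (Suc b')
    then show ?thesis by (cases b') (auto simp: p Rx_def Ry_def cadd_def algebra_simps)
  qed (auto simp: p Rx_def Ry_def cadd_def)
qed

lemma Ry_cadd: "Ry (cadd f g) = cadd (Ry f) (Ry g)"
  by (auto simp: Ry_def cadd_def fun_eq_iff)

lemma Ry_cscale: "Ry (cscale c f) = cscale c (Ry f)"
  by (auto simp: Ry_def cscale_def fun_eq_iff)

text \<open>The relation \<open>y^l x = x y^l + l y^(l+1)\<close>: moving x past each of the
  \<open>l\<close> factors y produces one extra \<open>y^(l+1)\<close>.\<close>

lemma Rx_Ry_pow: "Rx ((Ry ^^ l) f) = cadd ((Ry ^^ l) (Rx f)) (cscale (of_nat l) ((Ry ^^ Suc l) f))"
proof (induction l)
  case 0
  show ?case by (simp add: cadd_def cscale_def)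
next
  case (Suc l)
  have "Rx ((Ry ^^ Suc l) f) = cadd (Ry (Rx ((Ry ^^ l) f))) (Ry (Ry ((Ry ^^ l) f)))"
    by (simp add: Rx_Ry)
  also have "\<dots> = cadd ((Ry ^^ Suc l) (Rx f)) (cscale (of_nat (Suc l)) ((Ry ^^ Suc (Suc l)) f))"
    unfolding Suc Ry_cadd Ry_cscale by (simp add: cadd_def cscale_def algebra_simps fun_eq_iff)
  finally show ?case .
qed

lemma Ry_ract: "Ry (ract (k, l) f) = ract (k, Suc l) f"
  by (simp add: ract_def)

lemma Rx_ract: "Rx (ract (k, l) f) = cadd (ract (Suc k, l) f) (cscale (of_nat l) (ract (k, Suc l) f))"
  by (simp add: ract_def Rx_Ry_pow)

lemma jmult_mono_right: "jmult f (mono k l) = ract (k, l) f"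
proof -
  have "{q. mono k l q \<noteq> 0} = {(k, l)}" by (auto simp: mono_def)
  then show ?thesis by (simp add: jmult_def ract_def mono_def fun_eq_iff)
qed

lemma finsupp_Rx: "finsupp f \<Longrightarrow> finsupp (Rx f)"
  unfolding finsupp_def
proof (rule finite_subset)
  let ?S = "{p. f p \<noteq> 0}"
  show "{p. Rx f p \<noteq> 0} \<subseteq> map_prod Suc id ` ?S \<union> map_prod id Suc ` ?S"
  proof
    fix p assume "p \<in> {p. Rx f p \<noteq> 0}"
    then show "p \<in> map_prod Suc id ` ?S \<union> map_prod id Suc ` ?S"
      by (cases p; cases "fst p"; cases "snd p") (auto simp: Rx_def map_prod_def image_iff split: if_splits)
  qed
qed auto

lemma finsupp_Ry: "finsupp f \<Longrightarrow> finsupp (Ry f)"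
  unfolding finsupp_def
proof (rule finite_subset)
  show "{p. Ry f p \<noteq> 0} \<subseteq> map_prod id Suc ` {p. f p \<noteq> 0}"
  proof
    fix p assume "p \<in> {p. Ry f p \<noteq> 0}"
    then show "p \<in> map_prod id Suc ` {p. f p \<noteq> 0}"
      by (cases p; cases "snd p") (auto simp: Ry_def map_prod_def image_iff)
  qed
qed auto

lemma finsupp_ract:
  assumes "finsupp f"
  shows "finsupp (ract r f)"
proof -
  have "finsupp ((Rx ^^ k) f)" for k
    by (induction k) (use assms in \<open>auto intro: finsupp_Rx\<close>)
  then have "finsupp ((Ry ^^ l) ((Rx ^^ k) f))" for k l
    by (induction l) (auto intro: finsupp_Ry)
  then show ?thesis by (simp add: ract_def)
qed

lemma finsupp_jmult:
  assumes "finsupp f" "finsupp g"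
  shows "finsupp (jmult f g)"
  unfolding finsupp_def
proof (rule finite_subset)
  show "{p. jmult f g p \<noteq> 0} \<subseteq> (\<Union>q\<in>{q. g q \<noteq> 0}. {p. ract q f p \<noteq> 0})"
    by (auto simp: jmult_def ract_def elim!: sum.not_neutral_contains_not_neutral)
  show "finite (\<Union>q\<in>{q. g q \<noteq> 0}. {p. ract q f p \<noteq> 0})"
    using assms finsupp_ract[OF assms(1)] by (auto simp: finsupp_def)
qed

subsection \<open>The multiplication on formal series\<close>

text \<open>A product of monomials with indices \<open>q\<close> and \<open>r\<close> is homogeneous
  of degree \<open>deg q + deg r\<close>. Hence only finitely many pairs contribute at
  \<open>p\<close>, and the infinite sum is finite for arbitrary series. Leaving \<open>S\<close>
  and \<open>T\<close> free allows rectangles where index shifts are needed.\<close>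

lemma emult_eq_sum2:
  assumes "finite S" "tri (deg p) \<subseteq> S" "finite T" "tri (deg p) \<subseteq> T"
  shows "emult a b p = (\<Sum>q\<in>S. \<Sum>r\<in>T. a q * b r * ract r (mono (fst q) (snd q)) p)"
proof -
  have z: "ract r (mono (fst q) (snd q)) p = 0" if "q \<notin> S \<or> r \<notin> T" for q r
  proof (cases "r \<in> T")
    case False
    with assms have "deg p < deg r" by (auto simp: tri_def not_le[symmetric])
    then show ?thesis by (rule ract_vanish)
  next
    case True
    with that assms have q: "deg p < deg q" by (auto simp: tri_def not_le[symmetric])
    \<comment> \<open>Up to degree \<open>deg p\<close> the monomial agrees with the zero series,
      written as an empty linear combination so that \<open>ract_lincomb\<close> sends it to
      zero.\<close>
    have "ract r (mono (fst q) (snd q)) p = ract r (\<lambda>p. \<Sum>i\<in>{}. 0 * mono 0 0 p) p"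
      using q by (intro ract_local[where n = "deg p"]) (auto simp: mono_def deg_def)
    then show ?thesis by (subst (asm) ract_lincomb) simp
  qed
  have "emult a b p = infsum (\<lambda>(q, r). a q * b r * ract r (mono (fst q) (snd q)) p) (S \<times> T)"
    unfolding emult_def jmult_mono_right
    using z by (intro infsum_cong_neutral) (force split: prod.splits)+
  also have "\<dots> = (\<Sum>(q, r)\<in>S \<times> T. a q * b r * ract r (mono (fst q) (snd q)) p)"
    using assms by simp
  finally show ?thesis using assms by (simp add: sum.cartesian_product)
qed

text \<open>Summing over the left index first reassembles the whole series \<open>a\<close>, so the
  product is the combined right action of the monomials of \<open>b\<close>.\<close>

lemma emult_eq_sum:
  assumes "finite T" "tri (deg p) \<subseteq> T"
  shows "emult a b p = (\<Sum>r\<in>T. b r * ract r a p)"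
proof -
  have "emult a b p = (\<Sum>q\<in>tri (deg p). \<Sum>r\<in>T. a q * b r * ract r (mono (fst q) (snd q)) p)"
    by (rule emult_eq_sum2) (use assms in auto)
  also have "\<dots> = (\<Sum>r\<in>T. b r * ract r a p)"
    by (subst sum.swap)
      (simp add: ract_eq_sum_mono[where f = a and S = "tri (deg p)"] sum_distrib_left algebra_simps)
  finally show ?thesis .
qed

lemma emult_eq_jmult:
  assumes "finsupp g"
  shows "emult f g = jmult f g"
proof
  fix p
  \<comment> \<open>Large enough for both descriptions: \<open>jmult\<close> sums over the support
    of \<open>g\<close>, while \<open>emult_eq_sum\<close> asks for the triangle.\<close>
  let ?T = "{q. g q \<noteq> 0} \<union> tri (deg p)"
  have "emult f g p = (\<Sum>r\<in>?T. g r * ract r f p)"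
    by (rule emult_eq_sum) (use assms in \<open>auto simp: finsupp_def\<close>)
  also have "\<dots> = (\<Sum>r\<in>{q. g q \<noteq> 0}. g r * ract r f p)"
    by (rule sum.mono_neutral_right) (use assms in \<open>auto simp: finsupp_def\<close>)
  finally show "emult f g p = jmult f g p" by (simp add: jmult_def ract_def)
qed

lemma emult_cadd_left: "emult (cadd a b) c = cadd (emult a c) (emult b c)"
  by (rule ext) (simp add: emult_eq_sum2[OF finite_tri order_refl finite_tri order_refl] cadd_def
      sum.distrib algebra_simps)

lemma emult_cadd_right: "emult c (cadd a b) = cadd (emult c a) (emult c b)"
  by (rule ext) (simp add: emult_eq_sum2[OF finite_tri order_refl finite_tri order_refl] cadd_def
      sum.distrib algebra_simps)

lemma emult_cscale_left: "emult (cscale s a) b = cscale s (emult a b)"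
  by (rule ext) (simp add: emult_eq_sum2[OF finite_tri order_refl finite_tri order_refl] cscale_def
      sum_distrib_left algebra_simps)

lemma emult_cscale_right: "emult a (cscale s b) = cscale s (emult a b)"
  by (rule ext) (simp add: emult_eq_sum2[OF finite_tri order_refl finite_tri order_refl] cscale_def
      sum_distrib_left algebra_simps)

lemma emult_mono_right: "emult a (mono k l) = ract (k, l) a"
  by (simp add: emult_eq_jmult jmult_mono_right)

lemma emult_one_right: "emult a (mono 0 0) = a"
  by (simp add: emult_mono_right ract_def)

lemma Rx_mono: "Rx (mono i j) = cadd (mono (Suc i) j) (cscale (of_nat j) (mono i (Suc j)))"
  by (auto simp: Rx_def mono_def cadd_def cscale_def fun_eq_iff)

lemma Ry_mono: "Ry (mono i j) = mono i (Suc j)"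
  by (auto simp: Ry_def mono_def fun_eq_iff)

lemma Rx_pow_one: "(Rx ^^ k) (mono 0 0) = mono k 0"
  by (induction k) (simp_all add: Rx_mono, simp add: cadd_def cscale_def)

lemma Ry_pow_mono: "(Ry ^^ l) (mono k 0) = mono k l"
  by (induction l) (simp_all add: Ry_mono)

lemma ract_one: "ract r (mono 0 0) = mono (fst r) (snd r)"
  by (simp add: ract_def Rx_pow_one Ry_pow_mono)

lemma emult_one_left: "emult (mono 0 0) a = a"
proof
  fix p
  have "emult (mono 0 0) a p = (\<Sum>r\<in>tri (deg p). a r * mono (fst r) (snd r) p)"
    by (simp add: emult_eq_sum[OF finite_tri order_refl] ract_one)
  also have "\<dots> = (\<Sum>r\<in>tri (deg p). if r = p then a r else 0)"
    by (rule sum.cong) (auto simp: mono_def)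
  finally show "emult (mono 0 0) a p = a p"
    by (simp add: tri_def[of "deg p"] sum.delta[OF finite_tri[unfolded tri_def]])
qed

section \<open>Associativity, first with a generator as the third factor\<close>

lemma emult_Ry: "emult a (Ry b) = Ry (emult a b)"
proof
  fix p :: "nat \<times> nat"
  obtain u v where p: "p = (u, v)" by (cases p)
  let ?n = "deg p"
  \<comment> \<open>Rectangles let the y-exponent be shifted independently of the x-exponent; the
    extra column \<open>Suc ?n\<close> leaves room for the shift.\<close>
  have sub: "tri (deg p) \<subseteq> {..?n} \<times> {..Suc ?n}" "tri (deg (u, v - 1)) \<subseteq> {..?n} \<times> {..?n}"
    by (auto simp: tri_def deg_def p)
  have "emult a (Ry b) p = (\<Sum>k\<le>?n. \<Sum>l\<le>Suc ?n. Ry b (k, l) * ract (k, l) a p)"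
    by (subst emult_eq_sum[OF _ sub(1)]) (simp_all add: sum.cartesian_product del: sum.atMost_Suc)
  also have "\<dots> = (\<Sum>k\<le>?n. \<Sum>l\<le>?n. b (k, l) * ract (k, Suc l) a p)"
    by (subst sum.atMost_Suc_shift) (simp add: Ry_def)
  also have "\<dots> = (if 0 < v then (\<Sum>k\<le>?n. \<Sum>l\<le>?n. b (k, l) * ract (k, l) a (u, v - 1)) else 0)"
    by (auto simp: Ry_ract[symmetric] p) (auto simp: Ry_def)
  also have "(\<Sum>k\<le>?n. \<Sum>l\<le>?n. b (k, l) * ract (k, l) a (u, v - 1)) = emult a b (u, v - 1)"
    by (subst emult_eq_sum[OF _ sub(2)]) (simp_all add: sum.cartesian_product)
  finally show "emult a (Ry b) p = Ry (emult a b) p" by (simp add: p Ry_def)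
qed

text \<open>After index shifts, the two terms of \<open>Rx b\<close> match the two terms into which
  \<open>Rx_ract\<close> expands \<open>a x^k y^l x\<close>.\<close>

lemma emult_Rx: "emult a (Rx b) = Rx (emult a b)"
proof
  fix p :: "nat \<times> nat"
  obtain u v where p: "p = (u, v)" by (cases p)
  let ?n = "deg p"
  let ?E = "\<lambda>p'. \<Sum>k\<le>?n. \<Sum>l\<le>?n. b (k, l) * ract (k, l) a p'"
  have sub: "tri (deg p) \<subseteq> {..Suc ?n} \<times> {..Suc ?n}" by (auto simp: tri_def deg_def)
  have E: "emult a b p' = ?E p'" if "deg p' \<le> ?n" for p'
  proof -
    have "tri (deg p') \<subseteq> {..?n} \<times> {..?n}" using that by (auto simp: tri_def deg_def)
    then show ?thesis
      by (subst emult_eq_sum[where T = "{..?n} \<times> {..?n}"]) (simp_all add: sum.cartesian_product)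
  qed
  define F where "F = (\<lambda>k l. ract (k, l) a p)"
  \<comment> \<open>The surplus row and column left over by the shifts lie in degree above
    \<open>deg p\<close> and contribute nothing.\<close>
  have F0: "F (Suc ?n) l = 0" "F k (Suc ?n) = 0" for k l
    unfolding F_def by (rule ract_vanish; simp add: deg_def)+
  have "emult a (Rx b) p = (\<Sum>k\<le>Suc ?n. \<Sum>l\<le>Suc ?n. Rx b (k, l) * F k l)"
    unfolding F_def
    by (subst emult_eq_sum[OF _ sub]) (simp_all add: sum.cartesian_product del: sum.atMost_Suc)
  also have "\<dots> = (\<Sum>k\<le>Suc ?n. \<Sum>l\<le>Suc ?n. (if 0 < k then b (k - 1, l) * F k l else 0)) +
      (\<Sum>k\<le>Suc ?n. \<Sum>l\<le>Suc ?n. (if 0 < l then of_nat (l - 1) * b (k, l - 1) * F k l else 0))"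
    by (simp add: Rx_def sum.distrib[symmetric] distrib_right if_distrib[of "\<lambda>x. x * _"] cong: if_cong
        del: sum.atMost_Suc)
  also have "(\<Sum>k\<le>Suc ?n. \<Sum>l\<le>Suc ?n. (if 0 < k then b (k - 1, l) * F k l else 0)) =
      (\<Sum>k\<le>?n. \<Sum>l\<le>?n. b (k, l) * F (Suc k) l)"
    by (subst sum.atMost_Suc_shift) (simp add: F0)
  also have "(\<Sum>k\<le>Suc ?n. \<Sum>l\<le>Suc ?n. (if 0 < l then of_nat (l - 1) * b (k, l - 1) * F k l else 0)) =
      (\<Sum>k\<le>Suc ?n. \<Sum>l\<le>?n. of_nat l * b (k, l) * F k (Suc l))"
    by (rule sum.cong[OF refl], subst sum.atMost_Suc_shift) simp
  also have "\<dots> = (\<Sum>k\<le>?n. \<Sum>l\<le>?n. of_nat l * b (k, l) * F k (Suc l))"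
    by (simp add: F0)
  also have "(\<Sum>k\<le>?n. \<Sum>l\<le>?n. b (k, l) * F (Suc k) l) + (\<Sum>k\<le>?n. \<Sum>l\<le>?n. of_nat l * b (k, l) * F k (Suc l))
     = (\<Sum>k\<le>?n. \<Sum>l\<le>?n. b (k, l) * Rx (ract (k, l) a) p)"
    by (simp add: Rx_ract cadd_def cscale_def F_def sum.distrib[symmetric] algebra_simps)
  also have "\<dots> = Rx ?E p"
    by (simp add: sum.cartesian_product Rx_lincomb case_prod_unfold)
  \<comment> \<open>\<open>?E\<close> is known to be the product only up to degree
    \<open>?n\<close>, which is all that \<open>Rx\<close> sees at \<open>p\<close>.\<close>
  also have "\<dots> = Rx (emult a b) p"
    by (rule Rx_local[where n = ?n]) (use E in auto)
  finally show "emult a (Rx b) p = Rx (emult a b) p" .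
qed

lemma emult_ract: "emult a (ract r b) = ract r (emult a b)"
proof -
  have x: "emult a ((Rx ^^ k) b) = (Rx ^^ k) (emult a b)" for k
    by (induction k) (simp_all add: emult_Rx)
  have "emult a ((Ry ^^ l) b) = (Ry ^^ l) (emult a b)" for l b
    by (induction l) (simp_all add: emult_Ry)
  with x show ?thesis by (simp add: ract_def)
qed

text \<open>Expanding \<open>c\<close> into monomials reduces the claim to
  \<open>emult_ract\<close>; what remains is a swap of two finite sums.\<close>

lemma emult_assoc: "emult (emult a b) c = emult a (emult b c)"
proof
  fix p
  let ?T = "tri (deg p)"
  have *: "emult b c s = (\<Sum>r\<in>?T. c r * ract r b s)" if "s \<in> ?T" for s
    using that by (intro emult_eq_sum tri_mono finite_tri) (auto simp: tri_def)
  have "emult (emult a b) c p = (\<Sum>r\<in>?T. c r * emult a (ract r b) p)"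
    by (simp add: emult_eq_sum[OF finite_tri order_refl] emult_ract)
  also have "\<dots> = (\<Sum>r\<in>?T. \<Sum>s\<in>?T. c r * (ract r b s * ract s a p))"
    by (simp add: emult_eq_sum[OF finite_tri order_refl] sum_distrib_left)
  also have "\<dots> = (\<Sum>s\<in>?T. emult b c s * ract s a p)"
    by (subst sum.swap) (simp add: * sum_distrib_left sum_distrib_right algebra_simps)
  also have "\<dots> = emult a (emult b c) p"
    by (simp add: emult_eq_sum[OF finite_tri order_refl])
  finally show "emult (emult a b) c p = emult a (emult b c) p" .
qed

subsection \<open>Norm estimates\<close>

lemma rterm_nonneg [simp]: "0 \<le> \<rho> \<Longrightarrow> 0 \<le> rterm \<rho> f p"
  by (cases p) (simp add: rterm_def)

lemma rterm_cadd_le: "0 \<le> \<rho> \<Longrightarrow> rterm \<rho> (cadd f g) p \<le> rterm \<rho> f p + rterm \<rho> g p"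
  by (cases p)
    (auto simp: rterm_def cadd_def add_divide_distrib[symmetric] distrib_right[symmetric]
      intro!: divide_right_mono mult_right_mono norm_triangle_ineq)

lemma rterm_cscale: "rterm \<rho> (cscale c f) = (\<lambda>p. norm c * rterm \<rho> f p)"
  by (auto simp: rterm_def cscale_def norm_mult)

lemma rnorm_nonneg [simp]: "0 \<le> \<rho> \<Longrightarrow> 0 \<le> rnorm \<rho> f"
  unfolding rnorm_def by (rule infsum_nonneg) simp

lemma sum_rterm_le_rnorm:
  "0 \<le> \<rho> \<Longrightarrow> rterm \<rho> f summable_on UNIV \<Longrightarrow> finite F \<Longrightarrow> sum (rterm \<rho> f) F \<le> rnorm \<rho> f"
  unfolding rnorm_def by (rule finite_sum_le_infsum) auto

text \<open>The terms are nonnegative, so one bound on all finite partial sums gives summability and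
  the norm estimate together.\<close>

lemma
  assumes "0 \<le> \<rho>" "\<And>F. finite F \<Longrightarrow> sum (rterm \<rho> f) F \<le> C"
  shows summable_rtermI: "rterm \<rho> f summable_on UNIV" and rnorm_leI: "rnorm \<rho> f \<le> C"
proof -
  show *: "rterm \<rho> f summable_on UNIV"
    by (rule nonneg_bdd_above_summable_on) (use assms in \<open>auto intro!: bdd_aboveI[of _ C]\<close>)
  show "rnorm \<rho> f \<le> C"
    unfolding rnorm_def by (rule infsum_le_finite_sums[OF *]) (use assms in auto)
qed

lemma EhatD: "f \<in> Ehat \<Longrightarrow> 0 < \<rho> \<Longrightarrow> rterm \<rho> f summable_on UNIV"
  by (simp add: Ehat_def)

lemma
  assumes "0 \<le> \<rho>" "rterm \<rho> f summable_on UNIV" "rterm \<rho> g summable_on UNIV"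
  shows summable_rterm_cadd: "rterm \<rho> (cadd f g) summable_on UNIV"
    and rnorm_cadd_le: "rnorm \<rho> (cadd f g) \<le> rnorm \<rho> f + rnorm \<rho> g"
proof -
  have "sum (rterm \<rho> (cadd f g)) F \<le> rnorm \<rho> f + rnorm \<rho> g" if "finite F" for F
  proof -
    have "sum (rterm \<rho> (cadd f g)) F \<le> sum (rterm \<rho> f) F + sum (rterm \<rho> g) F"
      unfolding sum.distrib[symmetric] by (intro sum_mono rterm_cadd_le assms)
    also have "\<dots> \<le> rnorm \<rho> f + rnorm \<rho> g"
      by (intro add_mono sum_rterm_le_rnorm that assms)
    finally show ?thesis .
  qed
  then show "rterm \<rho> (cadd f g) summable_on UNIV" "rnorm \<rho> (cadd f g) \<le> rnorm \<rho> f + rnorm \<rho> g"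
    using assms(1) by (auto intro: summable_rtermI rnorm_leI)
qed

lemma rnorm_cscale: "rnorm \<rho> (cscale c f) = norm c * rnorm \<rho> f"
  unfolding rnorm_def rterm_cscale by (rule infsum_cmult_right')

lemma Ehat_cadd: "a \<in> Ehat \<Longrightarrow> b \<in> Ehat \<Longrightarrow> cadd a b \<in> Ehat"
  by (simp add: Ehat_def summable_rterm_cadd)

lemma Ehat_cscale: "a \<in> Ehat \<Longrightarrow> cscale c a \<in> Ehat"
  by (simp add: Ehat_def rterm_cscale summable_on_cmult_right)

lemma summable_rterm_finsupp: "finsupp f \<Longrightarrow> rterm \<rho> f summable_on UNIV"
  unfolding finsupp_def
  by (rule finite_nonzero_values_imp_summable_on, rule finite_subset[of _ "{p. f p \<noteq> 0}"])
    (auto simp: rterm_def)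

lemma Ehat_finsupp: "finsupp f \<Longrightarrow> f \<in> Ehat"
  by (simp add: Ehat_def summable_rterm_finsupp)

text \<open>\<open>P\<close> marks the indices where the shift \<open>s\<close> makes sense.
  Injectivity there turns the left side into a partial sum of \<open>rnorm \<rho> f\<close>.\<close>

lemma sum_rterm_shift_le:
  assumes "0 \<le> \<rho>" "rterm \<rho> f summable_on UNIV" "finite F" "inj_on s {p \<in> F. P p}"
  shows "(\<Sum>p\<in>F. if P p then rterm \<rho> f (s p) else 0) \<le> rnorm \<rho> f"
proof -
  have "(\<Sum>p\<in>F. if P p then rterm \<rho> f (s p) else 0) = sum (rterm \<rho> f) (s ` {p \<in> F. P p})"
    using assms by (simp add: sum.inter_filter[symmetric] sum.reindex)
  then show ?thesis using assms by (simp add: sum_rterm_le_rnorm)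
qed

text \<open>Each of the two terms of \<open>Rx\<close> costs at most \<open>\<rho>\<close>. In the
  second, the coefficient \<open>b - 1\<close> is absorbed by the weight: passing from
  \<open>(b-1)!\<close> to \<open>b!\<close> divides by \<open>b\<close>, and
  \<open>(b-1)/b \<le> 1\<close>.\<close>

lemma
  assumes "0 \<le> \<rho>" "rterm \<rho> f summable_on UNIV"
  shows summable_rterm_Rx: "rterm \<rho> (Rx f) summable_on UNIV"
    and rnorm_Rx_le: "rnorm \<rho> (Rx f) \<le> 2 * \<rho> * rnorm \<rho> f"
proof -
  have "sum (rterm \<rho> (Rx f)) F \<le> 2 * \<rho> * rnorm \<rho> f" if "finite F" for F
  proof -
    define g where "g = (\<lambda>p. if 0 < fst p then rterm \<rho> f (fst p - 1, snd p) else 0)"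
    define h where "h = (\<lambda>p. if 0 < snd p then rterm \<rho> f (fst p, snd p - 1) else 0)"
    have le: "rterm \<rho> (Rx f) p \<le> \<rho> * g p + \<rho> * h p" for p
    proof -
      obtain a b where p: "p = (a, b)" by (cases p)
      let ?A = "if 0 < a then f (a - 1, b) else 0"
      let ?B = "if 0 < b then of_nat (b - 1) * f (a, b - 1) else 0"
      have "rterm \<rho> (Rx f) p = norm (?A + ?B) * (\<rho> ^ (a + b) / fact b)"
        by (simp add: p rterm_def Rx_def)
      also have "\<dots> \<le> (norm ?A + norm ?B) * (\<rho> ^ (a + b) / fact b)"
        using assms(1) by (intro mult_right_mono norm_triangle_ineq) auto
      also have "\<dots> = norm ?A * (\<rho> ^ (a + b) / fact b) + norm ?B * (\<rho> ^ (a + b) / fact b)"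
        by (rule distrib_right)
      also have "norm ?A * (\<rho> ^ (a + b) / fact b) = \<rho> * g p"
        by (cases a) (simp_all add: p g_def rterm_def)
      also have "norm ?B * (\<rho> ^ (a + b) / fact b) \<le> \<rho> * h p"
      proof (cases b)
        case (Suc n)
        have "norm ?B * (\<rho> ^ (a + b) / fact b) = (real n / real (Suc n)) * (\<rho> * h p)"
          by (simp add: p h_def rterm_def Suc norm_mult field_simps)
        also have "\<dots> \<le> 1 * (\<rho> * h p)"
          using assms(1) by (intro mult_right_mono) (auto simp: h_def)
        finally show ?thesis by simp
      qed (simp add: h_def p)
      finally show ?thesis by simp
    qed
    have "sum (rterm \<rho> (Rx f)) F \<le> \<rho> * sum g F + \<rho> * sum h F"
      unfolding sum_distrib_left sum.distrib[symmetric] by (rule sum_mono) (rule le)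
    also have "\<dots> \<le> \<rho> * rnorm \<rho> f + \<rho> * rnorm \<rho> f"
      unfolding g_def h_def
      by (intro add_mono mult_left_mono sum_rterm_shift_le assms that)
        (auto simp: inj_on_def)
    finally show ?thesis by simp
  qed
  then show "rterm \<rho> (Rx f) summable_on UNIV" "rnorm \<rho> (Rx f) \<le> 2 * \<rho> * rnorm \<rho> f"
    using assms(1) by (auto intro: summable_rtermI rnorm_leI)
qed

lemma
  assumes "0 \<le> \<rho>" "rterm \<rho> f summable_on UNIV"
  shows summable_rterm_Rx_pow: "rterm \<rho> ((Rx ^^ k) f) summable_on UNIV"
    and rnorm_Rx_pow_le: "rnorm \<rho> ((Rx ^^ k) f) \<le> (2 * \<rho>) ^ k * rnorm \<rho> f"
proof -
  show *: "rterm \<rho> ((Rx ^^ k) f) summable_on UNIV" for k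
    by (induction k) (use assms in \<open>auto intro: summable_rterm_Rx\<close>)
  show "rnorm \<rho> ((Rx ^^ k) f) \<le> (2 * \<rho>) ^ k * rnorm \<rho> f"
  proof (induction k)
    case (Suc k)
    have "rnorm \<rho> ((Rx ^^ Suc k) f) \<le> 2 * \<rho> * rnorm \<rho> ((Rx ^^ k) f)"
      using rnorm_Rx_le[OF assms(1) *] by simp
    also have "\<dots> \<le> 2 * \<rho> * ((2 * \<rho>) ^ k * rnorm \<rho> f)"
      using assms(1) Suc by (intro mult_left_mono) auto
    finally show ?case by (simp add: mult.assoc)
  qed simp
qed

lemma Ry_pow: "(Ry ^^ l) f = (\<lambda>(a, b). if l \<le> b then f (a, b - l) else 0)"
  by (induction l) (auto simp: Ry_def fun_eq_iff)

text \<open>The gain \<open>1 / l!\<close> comes from \<open>l! c! \<le> (l + c)!\<close>, applied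
  to the weight at \<open>b = l + c\<close>.\<close>

lemma
  assumes "0 \<le> \<rho>" "rterm \<rho> f summable_on UNIV"
  shows summable_rterm_Ry_pow: "rterm \<rho> ((Ry ^^ l) f) summable_on UNIV"
    and rnorm_Ry_pow_le: "rnorm \<rho> ((Ry ^^ l) f) \<le> \<rho> ^ l / fact l * rnorm \<rho> f"
proof -
  have "sum (rterm \<rho> ((Ry ^^ l) f)) F \<le> \<rho> ^ l / fact l * rnorm \<rho> f" if "finite F" for F
  proof -
    define h where "h = (\<lambda>p. if l \<le> snd p then rterm \<rho> f (fst p, snd p - l) else 0)"
    have le: "rterm \<rho> ((Ry ^^ l) f) p \<le> \<rho> ^ l / fact l * h p" for p
    proof -
      obtain a b where p: "p = (a, b)" by (cases p)
      show ?thesis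
      proof (cases "l \<le> b")
        case True
        then obtain c where b: "b = l + c" using le_Suc_ex by blast
        have "fact l * fact c \<le> (fact b :: real)"
          using fact_fact_dvd_fact[of l c, where 'a = nat]
          by (metis b dvd_imp_le fact_gt_zero of_nat_fact of_nat_le_iff of_nat_mult)
        then have "1 / fact b \<le> 1 / (fact l * fact c :: real)"
          by (intro divide_left_mono) auto
        then have "norm (f (a, c)) * \<rho> ^ (a + b) * (1 / fact b)
            \<le> norm (f (a, c)) * \<rho> ^ (a + b) * (1 / (fact l * fact c))"
          using assms(1) by (intro mult_left_mono) auto
        then show ?thesis
          by (simp add: p Ry_pow h_def b rterm_def power_add mult_ac)
      qed (simp add: p Ry_pow h_def rterm_def)
    qed
    have "sum (rterm \<rho> ((Ry ^^ l) f)) F \<le> \<rho> ^ l / fact l * sum h F"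
      unfolding sum_distrib_left by (rule sum_mono) (rule le)
    also have "\<dots> \<le> \<rho> ^ l / fact l * rnorm \<rho> f"
      unfolding h_def using assms(1)
      by (intro mult_left_mono sum_rterm_shift_le assms that) (auto simp: inj_on_def)
    finally show ?thesis .
  qed
  then show "rterm \<rho> ((Ry ^^ l) f) summable_on UNIV"
    "rnorm \<rho> ((Ry ^^ l) f) \<le> \<rho> ^ l / fact l * rnorm \<rho> f"
    using assms(1) by (auto intro: summable_rtermI rnorm_leI)
qed

lemma
  assumes "0 \<le> \<rho>" "rterm \<rho> f summable_on UNIV"
  shows summable_rterm_ract: "rterm \<rho> (ract r f) summable_on UNIV"
    and rnorm_ract_le: "rnorm \<rho> (ract r f) \<le> (2 * \<rho>) ^ (fst r + snd r) / fact (snd r) * rnorm \<rho> f"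
proof -
  obtain k l where r: "r = (k, l)" by (cases r)
  note * = summable_rterm_Rx_pow[OF assms]
  show "rterm \<rho> (ract r f) summable_on UNIV"
    unfolding ract_def using assms(1) by (intro summable_rterm_Ry_pow *)
  have "rnorm \<rho> (ract r f) \<le> \<rho> ^ l / fact l * rnorm \<rho> ((Rx ^^ k) f)"
    unfolding ract_def r using rnorm_Ry_pow_le[OF assms(1) *] by simp
  \<comment> \<open>The factor \<open>2^l\<close> is given away so that the bound becomes exactly
    the weight of \<open>x^k y^l\<close> at radius \<open>2 * \<rho>\<close>.\<close>
  also have "\<dots> \<le> (2 * \<rho>) ^ l / fact l * ((2 * \<rho>) ^ k * rnorm \<rho> f)"
    using assms(1) by (intro mult_mono divide_right_mono power_mono rnorm_Rx_pow_le assms) auto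
  finally show "rnorm \<rho> (ract r f) \<le> (2 * \<rho>) ^ (fst r + snd r) / fact (snd r) * rnorm \<rho> f"
    by (simp add: r power_add mult_ac)
qed

text \<open>Summing the bounds for the monomials of \<open>b\<close> gives their weighted sum at
  radius \<open>2 * \<rho>\<close>. The change of radius is why operator norms are introduced to
  obtain submultiplicativity.\<close>

lemma
  assumes "0 \<le> \<rho>" "rterm \<rho> a summable_on UNIV" "rterm (2 * \<rho>) b summable_on UNIV"
  shows summable_rterm_emult: "rterm \<rho> (emult a b) summable_on UNIV"
    and rnorm_emult_le: "rnorm \<rho> (emult a b) \<le> rnorm \<rho> a * rnorm (2 * \<rho>) b"
proof -
  have "sum (rterm \<rho> (emult a b)) F \<le> rnorm \<rho> a * rnorm (2 * \<rho>) b" if "finite F" for F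
  proof -
    define T where "T = (\<Union>p\<in>F. tri (deg p))"
    have T: "finite T" using that by (simp add: T_def)
    have le: "rterm \<rho> (emult a b) p \<le> (\<Sum>r\<in>T. norm (b r) * rterm \<rho> (ract r a) p)" if "p \<in> F" for p
    proof -
      obtain u v where p: "p = (u, v)" by (cases p)
      have "emult a b p = (\<Sum>r\<in>T. b r * ract r a p)"
        by (rule emult_eq_sum) (use T that in \<open>auto simp: T_def\<close>)
      then have "norm (emult a b p) \<le> (\<Sum>r\<in>T. norm (b r) * norm (ract r a p))"
        by (simp add: norm_mult[symmetric] norm_sum)
      then have "norm (emult a b p) * (\<rho> ^ (u + v) / fact v)
          \<le> (\<Sum>r\<in>T. norm (b r) * norm (ract r a p)) * (\<rho> ^ (u + v) / fact v)"
        using assms(1) by (intro mult_right_mono) auto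
      then show ?thesis by (simp add: p rterm_def sum_distrib_left sum_distrib_right sum_divide_distrib mult_ac)
    qed
    have "sum (rterm \<rho> (emult a b)) F \<le> (\<Sum>p\<in>F. \<Sum>r\<in>T. norm (b r) * rterm \<rho> (ract r a) p)"
      by (rule sum_mono) (rule le)
    also have "\<dots> = (\<Sum>r\<in>T. norm (b r) * sum (rterm \<rho> (ract r a)) F)"
      by (subst sum.swap) (simp add: sum_distrib_left)
    also have "\<dots> \<le> (\<Sum>r\<in>T. norm (b r) * ((2 * \<rho>) ^ (fst r + snd r) / fact (snd r) * rnorm \<rho> a))"
    proof (intro sum_mono mult_left_mono)
      fix r
      have "sum (rterm \<rho> (ract r a)) F \<le> rnorm \<rho> (ract r a)"
        using assms that by (intro sum_rterm_le_rnorm summable_rterm_ract)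
      also have "\<dots> \<le> (2 * \<rho>) ^ (fst r + snd r) / fact (snd r) * rnorm \<rho> a"
        by (rule rnorm_ract_le) (use assms in auto)
      finally show "sum (rterm \<rho> (ract r a)) F \<le> (2 * \<rho>) ^ (fst r + snd r) / fact (snd r) * rnorm \<rho> a" .
    qed auto
    also have "\<dots> = rnorm \<rho> a * sum (rterm (2 * \<rho>) b) T"
      unfolding sum_distrib_left by (rule sum.cong) (auto simp: rterm_def)
    also have "\<dots> \<le> rnorm \<rho> a * rnorm (2 * \<rho>) b"
      using assms T by (intro mult_left_mono sum_rterm_le_rnorm) auto
    finally show ?thesis .
  qed
  then show "rterm \<rho> (emult a b) summable_on UNIV" "rnorm \<rho> (emult a b) \<le> rnorm \<rho> a * rnorm (2 * \<rho>) b"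
    using assms(1) by (auto intro: summable_rtermI rnorm_leI)
qed

lemma Ehat_emult: "a \<in> Ehat \<Longrightarrow> b \<in> Ehat \<Longrightarrow> emult a b \<in> Ehat"
  by (simp add: Ehat_def summable_rterm_emult)

lemma rnorm_one: "0 \<le> \<rho> \<Longrightarrow> rnorm \<rho> (mono 0 0) = 1"
proof -
  have "rnorm \<rho> (mono 0 0) = infsum (rterm \<rho> (mono 0 0)) {(0, 0)}"
    unfolding rnorm_def by (rule infsum_cong_neutral) (auto simp: rterm_def mono_def split: if_splits)
  then show ?thesis by (simp add: rterm_def mono_def)
qed

subsection \<open>Operator norms\<close>

text \<open>The operator norm of right multiplication by \<open>b\<close>. For \<open>a = 0\<close>
  the quotient is \<open>0 / 0 = 0\<close>, so zero may stay in the index set.\<close>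

definition opnorm :: "real \<Rightarrow> coef \<Rightarrow> real" where
  "opnorm \<rho> b = (SUP a\<in>Ehat. rnorm \<rho> (emult a b) / rnorm \<rho> a)"

lemma one_in_Ehat [simp]: "mono 0 0 \<in> Ehat"
  by (simp add: Ehat_finsupp)

lemma divide_le_of_nonneg:
  fixes x y C :: real
  assumes "x \<le> C * y" "0 \<le> y" "0 \<le> C"
  shows "x / y \<le> C"
  using assms by (cases "y = 0") (auto simp: divide_le_eq)

lemma opnorm_leI:
  assumes "0 < \<rho>" "0 \<le> C" "\<And>a. a \<in> Ehat \<Longrightarrow> rnorm \<rho> (emult a b) \<le> C * rnorm \<rho> a"
  shows "opnorm \<rho> b \<le> C"
  unfolding opnorm_def
proof (rule cSUP_least)
  fix a assume "a \<in> Ehat"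
  then show "rnorm \<rho> (emult a b) / rnorm \<rho> a \<le> C"
    using assms by (intro divide_le_of_nonneg) auto
next
  show "Ehat \<noteq> {}" using one_in_Ehat by blast
qed

text \<open>The quotients are bounded by \<open>rnorm (2 * \<rho>) b\<close>, so the supremum is a
  true upper bound; if \<open>a\<close> has norm zero, the same estimate gives zero on the
  left.\<close>

lemma rnorm_emult_le_opnorm:
  assumes "0 < \<rho>" "a \<in> Ehat" "b \<in> Ehat"
  shows "rnorm \<rho> (emult a b) \<le> opnorm \<rho> b * rnorm \<rho> a"
proof -
  have le: "rnorm \<rho> (emult a b) \<le> rnorm \<rho> a * rnorm (2 * \<rho>) b" if "a \<in> Ehat" for a
    using assms that by (intro rnorm_emult_le) (auto intro: EhatD)
  have nn: "0 \<le> rnorm \<rho> a" for a using assms(1) by simp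
  show ?thesis
  proof (cases "rnorm \<rho> a = 0")
    case False
    have "rnorm \<rho> (emult a b) / rnorm \<rho> a \<le> opnorm \<rho> b"
      unfolding opnorm_def
    proof (rule cSUP_upper[OF assms(2)], rule bdd_aboveI2)
      fix a assume "a \<in> Ehat"
      then show "rnorm \<rho> (emult a b) / rnorm \<rho> a \<le> rnorm (2 * \<rho>) b"
        using le[of a] assms by (intro divide_le_of_nonneg) (auto simp: mult.commute)
    qed
    then show ?thesis using False nn[of a] by (simp add: pos_divide_le_eq less_le)
  qed (use le[OF assms(2)] in simp)
qed

lemma opnorm_le_rnorm:
  assumes "0 < \<rho>" "b \<in> Ehat"
  shows "opnorm \<rho> b \<le> rnorm (2 * \<rho>) b"
proof (rule opnorm_leI)
  fix a assume "a \<in> Ehat"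
  then show "rnorm \<rho> (emult a b) \<le> rnorm (2 * \<rho>) b * rnorm \<rho> a"
    using assms rnorm_emult_le[of \<rho> a b] by (simp add: EhatD mult.commute)
qed (use assms in auto)

text \<open>Test the operator on the unit, which has norm one. With \<open>opnorm_le_rnorm\<close>
  this shows that both families define the same topology.\<close>

lemma rnorm_le_opnorm: "0 < \<rho> \<Longrightarrow> b \<in> Ehat \<Longrightarrow> rnorm \<rho> b \<le> opnorm \<rho> b"
  using rnorm_emult_le_opnorm[of \<rho> "mono 0 0" b] by (simp add: emult_one_left rnorm_one)

lemma opnorm_nonneg: "0 < \<rho> \<Longrightarrow> b \<in> Ehat \<Longrightarrow> 0 \<le> opnorm \<rho> b"
  using rnorm_le_opnorm[of \<rho> b] rnorm_nonneg[of \<rho> b] by linarith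

lemma opnorm_cadd_le:
  assumes "0 < \<rho>" "b \<in> Ehat" "c \<in> Ehat"
  shows "opnorm \<rho> (cadd b c) \<le> opnorm \<rho> b + opnorm \<rho> c"
proof (rule opnorm_leI)
  fix a assume a: "a \<in> Ehat"
  have "rnorm \<rho> (emult a (cadd b c)) \<le> rnorm \<rho> (emult a b) + rnorm \<rho> (emult a c)"
    unfolding emult_cadd_right using assms a by (intro rnorm_cadd_le EhatD Ehat_emult) auto
  also have "\<dots> \<le> opnorm \<rho> b * rnorm \<rho> a + opnorm \<rho> c * rnorm \<rho> a"
    using assms a by (intro add_mono rnorm_emult_le_opnorm)
  finally show "rnorm \<rho> (emult a (cadd b c)) \<le> (opnorm \<rho> b + opnorm \<rho> c) * rnorm \<rho> a"
    by (simp add: distrib_right)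
qed (use assms opnorm_nonneg in auto)

lemma opnorm_cscale_le:
  assumes "0 < \<rho>" "b \<in> Ehat"
  shows "opnorm \<rho> (cscale c b) \<le> norm c * opnorm \<rho> b"
proof (rule opnorm_leI)
  fix a assume "a \<in> Ehat"
  then show "rnorm \<rho> (emult a (cscale c b)) \<le> norm c * opnorm \<rho> b * rnorm \<rho> a"
    using mult_left_mono[OF rnorm_emult_le_opnorm[OF assms(1) _ assms(2)], of a "norm c"]
    by (simp add: emult_cscale_right rnorm_cscale mult.assoc)
qed (use assms opnorm_nonneg in auto)

text \<open>For nonzero \<open>c\<close> the reverse inequality is \<open>opnorm_cscale_le\<close>
  for the scalar \<open>inverse c\<close>.\<close>

lemma opnorm_cscale:
  assumes "0 < \<rho>" "b \<in> Ehat"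
  shows "opnorm \<rho> (cscale c b) = norm c * opnorm \<rho> b"
proof (cases "c = 0")
  case True
  then show ?thesis
    using opnorm_cscale_le[OF assms, of c] opnorm_nonneg[OF assms(1) Ehat_cscale[OF assms(2)], of c]
    by simp
next
  case False
  have "cscale (inverse c) (cscale c b) = b"
    using False by (simp add: cscale_def field_simps)
  then have "opnorm \<rho> b \<le> norm (inverse c) * opnorm \<rho> (cscale c b)"
    using opnorm_cscale_le[OF assms(1) Ehat_cscale[OF assms(2)], of "inverse c" c] by simp
  then have "norm c * opnorm \<rho> b \<le> opnorm \<rho> (cscale c b)"
    using False by (simp add: norm_divide field_simps)
  with opnorm_cscale_le[OF assms] show ?thesis by (simp add: antisym)
qed

text \<open>By associativity, right multiplication by the product is right multiplication by
  \<open>b\<close> followed by that by \<open>c\<close>.\<close>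

lemma opnorm_emult_le:
  assumes "0 < \<rho>" "b \<in> Ehat" "c \<in> Ehat"
  shows "opnorm \<rho> (emult b c) \<le> opnorm \<rho> b * opnorm \<rho> c"
proof (rule opnorm_leI)
  fix a assume a: "a \<in> Ehat"
  have "rnorm \<rho> (emult a (emult b c)) \<le> opnorm \<rho> c * rnorm \<rho> (emult a b)"
    unfolding emult_assoc[symmetric] using assms a by (intro rnorm_emult_le_opnorm Ehat_emult)
  also have "\<dots> \<le> opnorm \<rho> c * (opnorm \<rho> b * rnorm \<rho> a)"
    using assms a by (intro mult_left_mono rnorm_emult_le_opnorm opnorm_nonneg)
  finally show "rnorm \<rho> (emult a (emult b c)) \<le> opnorm \<rho> b * opnorm \<rho> c * rnorm \<rho> a"
    by (simp add: mult_ac)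
qed (use assms opnorm_nonneg in auto)

subsection \<open>Completeness\<close>

text \<open>A single term is at most the whole sum, so the coefficient functionals are
  continuous.\<close>

lemma norm_le_rnorm:
  assumes "0 < \<rho>" "f \<in> Ehat"
  shows "norm (f (i, j)) \<le> rnorm \<rho> f * (fact j / \<rho> ^ (i + j))"
proof -
  have "rterm \<rho> f (i, j) \<le> rnorm \<rho> f"
    using sum_rterm_le_rnorm[of \<rho> f "{(i, j)}"] assms by (simp add: EhatD)
  then show ?thesis using assms by (simp add: rterm_def field_simps)
qed

text \<open>The limit is built coefficientwise. The Cauchy bounds pass to it through finite partial
  sums, where termwise convergence suffices.\<close>

lemma Ehat_complete:
  fixes s :: "nat \<Rightarrow> coef"
  assumes s: "\<And>n. s n \<in> Ehat"
    and cauchy: "\<And>\<rho> \<epsilon>. 0 < \<rho> \<Longrightarrow> 0 < \<epsilon> \<Longrightarrow>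
      \<exists>M. \<forall>m\<ge>M. \<forall>n\<ge>M. rnorm \<rho> (cadd (s m) (cscale (-1) (s n))) < \<epsilon>"
  shows "\<exists>L\<in>Ehat. \<forall>\<rho>>0. (\<lambda>n. rnorm \<rho> (cadd (s n) (cscale (-1) L))) \<longlonglongrightarrow> 0"
proof -
  let ?d = "\<lambda>f g. cadd f (cscale (-1) g)"
  have "Cauchy (\<lambda>n. s n p)" for p
  proof (rule metric_CauchyI)
    fix e :: real assume "0 < e"
    obtain i j where p: "p = (i, j)" by (cases p)
    obtain M where M: "\<forall>m\<ge>M. \<forall>n\<ge>M. rnorm 1 (?d (s m) (s n)) < e / fact j"
      using cauchy[of 1 "e / fact j"] \<open>0 < e\<close> by auto
    have "dist (s m p) (s n p) < e" if "m \<ge> M" "n \<ge> M" for m n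
    proof -
      have "dist (s m p) (s n p) \<le> rnorm 1 (?d (s m) (s n)) * fact j"
        using norm_le_rnorm[of 1 "?d (s m) (s n)" i j, OF _ Ehat_cadd[OF s Ehat_cscale[OF s]]]
        by (simp add: p cadd_def cscale_def dist_norm)
      also have "\<dots> < e" using M that by (simp add: field_simps)
      finally show ?thesis .
    qed
    then show "\<exists>M. \<forall>m\<ge>M. \<forall>n\<ge>M. dist (s m p) (s n p) < e" by blast
  qed
  then have "\<exists>l. (\<lambda>n. s n p) \<longlonglongrightarrow> l" for p
    by (simp add: Cauchy_convergent_iff convergent_def)
  then obtain L where L: "\<And>p. (\<lambda>n. s n p) \<longlonglongrightarrow> L p" by metis
  \<comment> \<open>Letting \<open>n\<close> tend to infinity in the Cauchy estimate, with
    \<open>m\<close> and the finite set \<open>F\<close> fixed, weakens the strict bound to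
    \<open>\<le> \<epsilon>\<close>.\<close>
  have key: "\<exists>M. \<forall>m\<ge>M. rterm \<rho> (?d (s m) L) summable_on UNIV \<and> rnorm \<rho> (?d (s m) L) \<le> \<epsilon>"
    if "0 < \<rho>" "0 < \<epsilon>" for \<rho> \<epsilon>
  proof -
    obtain M where M: "\<forall>m\<ge>M. \<forall>n\<ge>M. rnorm \<rho> (?d (s m) (s n)) < \<epsilon>"
      using cauchy[OF \<open>0 < \<rho>\<close> \<open>0 < \<epsilon>\<close>] by blast
    have "sum (rterm \<rho> (?d (s m) L)) F \<le> \<epsilon>" if "m \<ge> M" "finite F" for m F
    proof (rule tendsto_upperbound)
      have "(\<lambda>n. rterm \<rho> (?d (s m) (s n)) p) \<longlonglongrightarrow> rterm \<rho> (?d (s m) L) p" for p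
        by (cases p) (auto simp: rterm_def cadd_def cscale_def intro!: tendsto_intros L)
      then show "(\<lambda>n. sum (rterm \<rho> (?d (s m) (s n))) F) \<longlonglongrightarrow> sum (rterm \<rho> (?d (s m) L)) F"
        by (intro tendsto_sum)
      have "sum (rterm \<rho> (?d (s m) (s n))) F \<le> \<epsilon>" if "n \<ge> M" for n
      proof -
        have "sum (rterm \<rho> (?d (s m) (s n))) F \<le> rnorm \<rho> (?d (s m) (s n))"
          using \<open>0 < \<rho>\<close> \<open>finite F\<close> s
          by (intro sum_rterm_le_rnorm EhatD Ehat_cadd Ehat_cscale) auto
        then show ?thesis using M that \<open>m \<ge> M\<close> by (meson less_imp_le order_trans)
      qed
      then show "\<forall>\<^sub>F n in sequentially. sum (rterm \<rho> (?d (s m) (s n))) F \<le> \<epsilon>"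
        by (auto simp: eventually_sequentially)
    qed simp
    then show ?thesis
      using \<open>0 < \<rho>\<close> by (intro exI[of _ M] allI impI conjI summable_rtermI rnorm_leI) auto
  qed
  have "L \<in> Ehat"
    unfolding Ehat_def
  proof (intro CollectI allI impI)
    fix \<rho> :: real assume \<rho>: "0 < \<rho>"
    then obtain m where m: "rterm \<rho> (?d (s m) L) summable_on UNIV"
      using key[of \<rho> 1] by auto
    \<comment> \<open>Summability of \<open>L\<close> follows from that of \<open>s m\<close> and of
      the difference \<open>s m - L\<close>.\<close>
    have "L = cadd (s m) (cscale (-1) (?d (s m) L))"
      by (simp add: cadd_def cscale_def)
    moreover have "rterm \<rho> (cadd (s m) (cscale (-1) (?d (s m) L))) summable_on UNIV"
      using m \<rho> EhatD[OF s[of m]]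
      by (intro summable_rterm_cadd) (auto simp: rterm_cscale)
    ultimately show "rterm \<rho> L summable_on UNIV" by simp
  qed
  moreover have "(\<lambda>n. rnorm \<rho> (?d (s n) L)) \<longlonglongrightarrow> 0" if "0 < \<rho>" for \<rho>
  proof (rule LIMSEQ_I)
    fix r :: real assume "0 < r"
    then obtain M where "\<forall>m\<ge>M. rnorm \<rho> (?d (s m) L) \<le> r / 2"
      using key[OF \<open>0 < \<rho>\<close>, of "r / 2"] by auto
    then show "\<exists>no. \<forall>n\<ge>no. norm (rnorm \<rho> (?d (s n) L) - 0) < r"
      using \<open>0 < r\<close> \<open>0 < \<rho>\<close> by (intro exI[of _ M]) force
  qed
  ultimately show ?thesis by blast
qed

lemma Ehat_is_AM_algebra: Ehat_is_AM_algebra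
  unfolding Ehat_is_AM_algebra_def
proof (intro conjI)
  show "\<exists>N. (\<forall>q\<in>N. (\<forall>a\<in>Ehat. 0 \<le> q a)
              \<and> (\<forall>a\<in>Ehat. \<forall>b\<in>Ehat. q (cadd a b) \<le> q a + q b)
              \<and> (\<forall>c. \<forall>a\<in>Ehat. q (cscale c a) = norm c * q a)
              \<and> (\<forall>a\<in>Ehat. \<forall>b\<in>Ehat. q (emult a b) \<le> q a * q b)
              \<and> (\<exists>\<rho>>0. \<exists>C. \<forall>a\<in>Ehat. q a \<le> C * rnorm \<rho> a))
      \<and> (\<forall>\<rho>>0. \<exists>q\<in>N. \<exists>C. \<forall>a\<in>Ehat. rnorm \<rho> a \<le> C * q a)"
  \<comment> \<open>The operator norms at all radii serve as the family. Since
    \<open>opnorm \<rho>\<close> lies between \<open>rnorm \<rho>\<close> and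
    \<open>rnorm (2 * \<rho>)\<close>, all comparison constants are 1.\<close>
  proof (intro exI[of _ "opnorm ` {0<..}"] conjI ballI)
    fix q assume "q \<in> opnorm ` {0<..}"
    then obtain \<rho> where \<rho>: "0 < \<rho>" and q: "q = opnorm \<rho>" by auto
    show "\<exists>\<rho>>0. \<exists>C. \<forall>a\<in>Ehat. q a \<le> C * rnorm \<rho> a"
      using \<rho> opnorm_le_rnorm by (intro exI[of _ "2 * \<rho>"] conjI exI[of _ 1]) (auto simp: q)
  next
    show "\<forall>\<rho>>0. \<exists>q\<in>opnorm ` {0<..}. \<exists>C. \<forall>a\<in>Ehat. rnorm \<rho> a \<le> C * q a"
      by (auto intro!: bexI exI[of _ 1] simp: rnorm_le_opnorm)
  qed (auto simp: opnorm_nonneg opnorm_cadd_le opnorm_cscale opnorm_emult_le)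
qed (auto simp: Ehat_cadd Ehat_cscale Ehat_emult emult_assoc emult_one_left emult_one_right
    emult_cadd_left emult_cadd_right emult_cscale_left emult_cscale_right intro!: Ehat_complete)

subsection \<open>Convergence in the completion\<close>

definition cdiff :: "coef \<Rightarrow> coef \<Rightarrow> coef" where
  "cdiff f g = cadd f (cscale (-1) g)"

definition econv :: "(nat \<Rightarrow> coef) \<Rightarrow> coef \<Rightarrow> bool" where
  "econv s a \<longleftrightarrow> (\<forall>\<rho>>0. (\<lambda>n. rnorm \<rho> (cdiff (s n) a)) \<longlonglongrightarrow> 0)"

lemma econvD: "econv s a \<Longrightarrow> 0 < \<rho> \<Longrightarrow> (\<lambda>n. rnorm \<rho> (cdiff (s n) a)) \<longlonglongrightarrow> 0"
  by (simp add: econv_def)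

lemma Ehat_cdiff: "a \<in> Ehat \<Longrightarrow> b \<in> Ehat \<Longrightarrow> cdiff a b \<in> Ehat"
  by (simp add: cdiff_def Ehat_cadd Ehat_cscale)

lemma finsupp_cdiff: "finsupp f \<Longrightarrow> finsupp g \<Longrightarrow> finsupp (cdiff f g)"
  by (simp add: cdiff_def)

lemma rnorm_cdiff_commute: "rnorm \<rho> (cdiff f g) = rnorm \<rho> (cdiff g f)"
proof -
  have "cdiff f g = cscale (-1) (cdiff g f)"
    by (simp add: cdiff_def cadd_def cscale_def)
  then show ?thesis by (simp add: rnorm_cscale)
qed

lemma rnorm_triangle: "0 < \<rho> \<Longrightarrow> f \<in> Ehat \<Longrightarrow> g \<in> Ehat \<Longrightarrow> rnorm \<rho> (cadd f g) \<le> rnorm \<rho> f + rnorm \<rho> g"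
  by (intro rnorm_cadd_le) (auto intro: EhatD)

lemma rnorm_cdiff_triangle:
  assumes "0 < \<rho>" "f \<in> Ehat" "g \<in> Ehat" "h \<in> Ehat"
  shows "rnorm \<rho> (cdiff f h) \<le> rnorm \<rho> (cdiff f g) + rnorm \<rho> (cdiff h g)"
proof -
  have "cdiff f h = cadd (cdiff f g) (cdiff g h)"
    by (simp add: cdiff_def cadd_def cscale_def)
  then show ?thesis
    using rnorm_triangle[of \<rho> "cdiff f g" "cdiff g h"] assms
    by (simp add: Ehat_cdiff rnorm_cdiff_commute[of \<rho> h g])
qed

lemma null_sequence_le:
  fixes u v :: "nat \<Rightarrow> real"
  assumes "v \<longlonglongrightarrow> 0" "\<And>n. 0 \<le> u n" "\<And>n. u n \<le> v n"
  shows "u \<longlonglongrightarrow> 0"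
  by (rule tendsto_sandwich[OF _ _ tendsto_const assms(1)]) (use assms in auto)

text \<open>Density of the finite sums: the distance from \<open>a\<close> to its truncation is
  exactly the tail of a convergent series.\<close>

lemma econv_trunc:
  assumes "a \<in> Ehat"
  shows "econv (\<lambda>n. trunc n a) a"
  unfolding econv_def
proof (intro allI impI)
  fix \<rho> :: real assume \<rho>: "0 < \<rho>"
  note summ = EhatD[OF assms \<rho>]
  have eq: "rnorm \<rho> (cdiff (trunc n a) a) = rnorm \<rho> a - sum (rterm \<rho> a) (tri n)" for n
  proof -
    have "rnorm \<rho> (cdiff (trunc n a) a) = infsum (rterm \<rho> a) (UNIV - tri n)"
      unfolding rnorm_def
      by (rule infsum_cong_neutral) (auto simp: rterm_def cdiff_def cadd_def cscale_def trunc_def)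
    also have "\<dots> = infsum (rterm \<rho> a) UNIV - infsum (rterm \<rho> a) (tri n)"
      using summ by (intro infsum_Diff) auto
    finally show ?thesis by (simp add: rnorm_def)
  qed
  \<comment> \<open>Every finite set of indices lies in all large triangles, so the net of finite
    partial sums may be evaluated along the triangles.\<close>
  have "filterlim tri (finite_subsets_at_top UNIV) sequentially"
    unfolding filterlim_finite_subsets_at_top
  proof (intro allI impI)
    fix X :: "(nat \<times> nat) set" assume "finite X \<and> X \<subseteq> UNIV"
    then have fin: "finite X" by simp
    have "X \<subseteq> tri n" if "Max (insert 0 (deg ` X)) \<le> n" for n
      using fin that by (auto simp: tri_def)
    then show "\<forall>\<^sub>F n in sequentially. finite (tri n) \<and> X \<subseteq> tri n \<and> tri n \<subseteq> UNIV"
      by (auto simp: eventually_sequentially)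
  qed
  moreover have "(sum (rterm \<rho> a) \<longlongrightarrow> rnorm \<rho> a) (finite_subsets_at_top UNIV)"
    using has_sum_infsum[OF summ] by (simp add: has_sum_def rnorm_def)
  ultimately have "(\<lambda>n. sum (rterm \<rho> a) (tri n)) \<longlonglongrightarrow> rnorm \<rho> a"
    using filterlim_compose by blast
  then have "(\<lambda>n. rnorm \<rho> a - sum (rterm \<rho> a) (tri n)) \<longlonglongrightarrow> rnorm \<rho> a - rnorm \<rho> a"
    by (intro tendsto_diff tendsto_const)
  then show "(\<lambda>n. rnorm \<rho> (cdiff (trunc n a) a)) \<longlonglongrightarrow> 0" by (simp add: eq)
qed

lemma rnorm_trunc_le:
  assumes "a \<in> Ehat" "0 < \<rho>"
  shows "rnorm \<rho> (trunc n a) \<le> rnorm \<rho> a"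
proof (rule rnorm_leI)
  fix F :: "(nat \<times> nat) set" assume "finite F"
  have "rterm \<rho> (trunc n a) p \<le> rterm \<rho> a p" for p
    using assms by (cases p) (auto simp: rterm_def trunc_def)
  then have "sum (rterm \<rho> (trunc n a)) F \<le> sum (rterm \<rho> a) F" by (intro sum_mono)
  also have "\<dots> \<le> rnorm \<rho> a"
    using assms \<open>finite F\<close> by (intro sum_rterm_le_rnorm EhatD) auto
  finally show "sum (rterm \<rho> (trunc n a)) F \<le> rnorm \<rho> a" .
qed (use assms in auto)

lemma econv_const: "econv (\<lambda>n. f) f"
  by (auto simp: econv_def cdiff_def cadd_def cscale_def rnorm_def rterm_def case_prod_unfold)

lemma econv_cadd:
  assumes "\<And>n. s n \<in> Ehat" "\<And>n. t n \<in> Ehat" "a \<in> Ehat" "b \<in> Ehat" "econv s a" "econv t b"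
  shows "econv (\<lambda>n. cadd (s n) (t n)) (cadd a b)"
  unfolding econv_def
proof (intro allI impI)
  fix \<rho> :: real assume \<rho>: "0 < \<rho>"
  have eq: "cdiff (cadd (s n) (t n)) (cadd a b) = cadd (cdiff (s n) a) (cdiff (t n) b)" for n
    by (simp add: cdiff_def cadd_def cscale_def algebra_simps)
  show "(\<lambda>n. rnorm \<rho> (cdiff (cadd (s n) (t n)) (cadd a b))) \<longlonglongrightarrow> 0"
  proof (rule null_sequence_le)
    show "(\<lambda>n. rnorm \<rho> (cdiff (s n) a) + rnorm \<rho> (cdiff (t n) b)) \<longlonglongrightarrow> 0"
      using tendsto_add[OF econvD[OF assms(5) \<rho>] econvD[OF assms(6) \<rho>]] by simp
  qed (use \<rho> assms in \<open>auto simp: eq intro!: rnorm_triangle Ehat_cdiff\<close>)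
qed

lemma econv_cscale:
  assumes "econv s a"
  shows "econv (\<lambda>n. cscale c (s n)) (cscale c a)"
  unfolding econv_def
proof (intro allI impI)
  fix \<rho> :: real assume \<rho>: "0 < \<rho>"
  have eq: "cdiff (cscale c (s n)) (cscale c a) = cscale c (cdiff (s n) a)" for n
    by (simp add: cdiff_def cadd_def cscale_def algebra_simps)
  show "(\<lambda>n. rnorm \<rho> (cdiff (cscale c (s n)) (cscale c a))) \<longlonglongrightarrow> 0"
    unfolding eq rnorm_cscale by (intro tendsto_mult_right_zero econvD[OF assms \<rho>])
qed

text \<open>Joint continuity from \<open>st - ab = (s - a) t + a (t - b)\<close>, with right factors
  measured at radius \<open>2 * \<rho>\<close>.\<close>

lemma econv_emult:
  assumes "\<And>n. s n \<in> Ehat" "\<And>n. t n \<in> Ehat" "a \<in> Ehat" "b \<in> Ehat" "econv s a" "econv t b"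
  shows "econv (\<lambda>n. emult (s n) (t n)) (emult a b)"
  unfolding econv_def
proof (intro allI impI)
  fix \<rho> :: real assume \<rho>: "0 < \<rho>"
  define u where "u n = rnorm \<rho> (cdiff (s n) a)" for n
  define v where "v n = rnorm (2 * \<rho>) (cdiff (t n) b)" for n
  have uv: "u \<longlonglongrightarrow> 0" "v \<longlonglongrightarrow> 0"
    unfolding u_def v_def using assms \<rho> by (auto intro: econvD)
  have eq: "cdiff (emult (s n) (t n)) (emult a b) =
      cadd (emult (cdiff (s n) a) (t n)) (emult a (cdiff (t n) b))" for n
    unfolding cdiff_def emult_cadd_left emult_cadd_right emult_cscale_left emult_cscale_right
    by (simp add: cadd_def cscale_def)
  show "(\<lambda>n. rnorm \<rho> (cdiff (emult (s n) (t n)) (emult a b))) \<longlonglongrightarrow> 0"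
  proof (rule null_sequence_le)
    have "(\<lambda>n. u n * (v n + rnorm (2 * \<rho>) b) + rnorm \<rho> a * v n)
        \<longlonglongrightarrow> 0 * (0 + rnorm (2 * \<rho>) b) + rnorm \<rho> a * 0"
      by (intro tendsto_intros uv)
    then show "(\<lambda>n. u n * (v n + rnorm (2 * \<rho>) b) + rnorm \<rho> a * v n) \<longlonglongrightarrow> 0" by simp
    fix n
    \<comment> \<open>Splitting off \<open>b\<close> bounds the norm of \<open>t n\<close> by a
      convergent sequence.\<close>
    have t: "t n = cadd (cdiff (t n) b) b" by (simp add: cdiff_def cadd_def cscale_def)
    have tn: "rnorm (2 * \<rho>) (t n) \<le> v n + rnorm (2 * \<rho>) b"
      using rnorm_triangle[of "2 * \<rho>" "cdiff (t n) b" b] assms \<rho> t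
      by (simp add: Ehat_cdiff v_def)
    have "rnorm \<rho> (cdiff (emult (s n) (t n)) (emult a b))
        \<le> rnorm \<rho> (emult (cdiff (s n) a) (t n)) + rnorm \<rho> (emult a (cdiff (t n) b))"
      unfolding eq using assms \<rho> by (intro rnorm_triangle Ehat_emult Ehat_cdiff)
    also have "\<dots> \<le> u n * rnorm (2 * \<rho>) (t n) + rnorm \<rho> a * v n"
      unfolding u_def v_def using assms \<rho>
      by (intro add_mono rnorm_emult_le) (auto intro!: EhatD Ehat_cdiff)
    also have "\<dots> \<le> u n * (v n + rnorm (2 * \<rho>) b) + rnorm \<rho> a * v n"
      using tn \<rho> by (intro add_mono mult_left_mono order_refl) (auto simp: u_def)
    finally show "rnorm \<rho> (cdiff (emult (s n) (t n)) (emult a b))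
        \<le> u n * (v n + rnorm (2 * \<rho>) b) + rnorm \<rho> a * v n" .
  qed (use \<rho> in auto)
qed

subsection \<open>Homomorphisms into an Arens-Michael algebra\<close>

locale AM_hom =
  fixes sc :: "complex \<Rightarrow> 'b::ring_1 \<Rightarrow> 'b" and N :: "('b \<Rightarrow> real) set" and \<phi> :: "coef \<Rightarrow> 'b"
  assumes AM: "AM_algebra sc N" and hom: "lam_hom sc \<phi>"
begin

lemma alg: "cplx_alg sc" using AM by (simp add: AM_algebra_def)

lemma sc_zero: "sc 0 a = 0"
proof -
  have "sc (0 + 0) a = sc 0 a + sc 0 a" using alg unfolding cplx_alg_def by blast
  then show ?thesis by simp
qed

lemma sc_minus_one: "sc (-1) a = - a"
proof -
  have "sc (-1 + 1) a = sc (-1) a + sc 1 a" using alg unfolding cplx_alg_def by blast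
  moreover have "sc 1 a = a" using alg unfolding cplx_alg_def by blast
  ultimately show ?thesis by (simp add: sc_zero eq_neg_iff_add_eq_0)
qed

lemma sc_diff: "sc c (a - b) = sc c a - sc c b"
proof -
  have "sc c (a - b + b) = sc c (a - b) + sc c b" using alg unfolding cplx_alg_def by blast
  then show ?thesis by (simp add: algebra_simps)
qed

lemma
  assumes "q \<in> N"
  shows seminorm_nonneg: "0 \<le> q a"
    and seminorm_add: "q (a + b) \<le> q a + q b"
    and seminorm_sc: "q (sc c a) = norm c * q a"
    and seminorm_mult: "q (a * b) \<le> q a * q b"
  using AM assms by (auto simp: AM_algebra_def submult_seminorm_def)

lemma seminorm_minus: "q \<in> N \<Longrightarrow> q (- a) = q a"
  using seminorm_sc[of q "-1" a] by (simp add: sc_minus_one)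

lemma seminorm_zero: "q \<in> N \<Longrightarrow> q 0 = 0"
  using seminorm_sc[of q 0 0] by (simp add: sc_zero)

lemma seminorm_diff: "q \<in> N \<Longrightarrow> q (a - b) \<le> q a + q b"
  using seminorm_add[of q a "- b"] by (simp add: seminorm_minus)

lemma
  shows phi_cadd: "finsupp f \<Longrightarrow> finsupp g \<Longrightarrow> \<phi> (cadd f g) = \<phi> f + \<phi> g"
    and phi_cscale: "finsupp f \<Longrightarrow> \<phi> (cscale c f) = sc c (\<phi> f)"
    and phi_jmult: "finsupp f \<Longrightarrow> finsupp g \<Longrightarrow> \<phi> (jmult f g) = \<phi> f * \<phi> g"
    and phi_one: "\<phi> (mono 0 0) = 1"
  using hom by (auto simp: lam_hom_def)

lemma phi_cdiff: "finsupp f \<Longrightarrow> finsupp g \<Longrightarrow> \<phi> (cdiff f g) = \<phi> f - \<phi> g"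
  by (simp add: cdiff_def phi_cadd phi_cscale sc_minus_one)

section \<open>Images of monomials and continuity of the homomorphism\<close>

lemma phi_sum:
  assumes "finite S"
  shows "\<phi> (\<lambda>p. if p \<in> S then f p else 0) = (\<Sum>q\<in>S. sc (f q) (\<phi> (mono (fst q) (snd q))))"
  using assms
proof induction
  case empty
  \<comment> \<open>The zero series is presented as \<open>0\<close> times the unit, so that
    homogeneity gives its image.\<close>
  have "\<phi> (cscale 0 (mono 0 0)) = 0" by (simp add: phi_cscale sc_zero)
  then show ?case by (simp add: cscale_def)
next
  case (insert q S)
  have "(\<lambda>p. if p \<in> insert q S then f p else 0) =
      cadd (cscale (f q) (mono (fst q) (snd q))) (\<lambda>p. if p \<in> S then f p else 0)"
    using insert by (auto simp: cadd_def cscale_def mono_def)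
  moreover have "finsupp (\<lambda>p. if p \<in> S then f p else 0)"
    unfolding finsupp_def by (rule finite_subset[OF _ insert(1)]) auto
  ultimately show ?case using insert by (simp add: phi_cadd phi_cscale)
qed

lemma phi_mono_Suc: "\<phi> (mono (Suc i) j) = \<phi> (mono 1 0) * \<phi> (mono i j)"
proof -
  have "mono 1 0 = Rx (mono 0 0)" by (simp add: Rx_mono cadd_def cscale_def)
  then have "jmult (mono 1 0) (mono i j) = ract (Suc i, j) (mono 0 0)"
    by (simp add: jmult_mono_right ract_def funpow_swap1)
  then show ?thesis by (simp add: phi_jmult[symmetric] ract_one)
qed

text \<open>The image of \<open>y^n x - x y^n = n y^(n+1)\<close>, which expresses the next power of
  y by a commutator.\<close>

lemma phi_commutator:
  "sc (of_nat n) (\<phi> (mono 0 (Suc n))) = \<phi> (mono 0 n) * \<phi> (mono 1 0) - \<phi> (mono 1 0) * \<phi> (mono 0 n)"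
proof -
  have "\<phi> (mono 0 n) * \<phi> (mono 1 0) = \<phi> (Rx (mono 0 n))"
    by (simp add: phi_jmult[symmetric] jmult_mono_right ract_def)
  also have "\<dots> = \<phi> (mono 1 n) + sc (of_nat n) (\<phi> (mono 0 (Suc n)))"
    by (simp add: Rx_mono phi_cadd phi_cscale)
  finally show ?thesis using phi_mono_Suc[of 0 n] by simp
qed

lemma phi_mono_bound:
  assumes q: "q \<in> N"
  obtains \<rho> K where "0 < \<rho>" "0 \<le> K" "\<And>i j. q (\<phi> (mono i j)) \<le> K * (\<rho> ^ (i + j) / fact j)"
proof -
  let ?x = "q (\<phi> (mono 1 0))"
  let ?z = "\<lambda>n. q (\<phi> (mono 0 n))"
  \<comment> \<open>The 4 is the product of the 2 from the commutator estimate and the 2 from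
    \<open>m + 1 \<le> 2 m\<close>. Adding 1 gives \<open>1 \<le> \<rho>\<close> even if
    \<open>?x = 0\<close>.\<close>
  define \<rho> where "\<rho> = 4 * ?x + 1"
  \<comment> \<open>Covers both starting values \<open>?z 0 = q 1\<close> and
    \<open>?z 1\<close>.\<close>
  define K where "K = q 1 + ?z 1"
  note nn = seminorm_nonneg[OF q]
  have \<rho>: "1 \<le> \<rho>" "?x \<le> \<rho>" "4 * ?x \<le> \<rho>" using nn[of "\<phi> (mono 1 0)"] by (auto simp: \<rho>_def)
  have K: "0 \<le> K" by (simp add: K_def nn)
  have step: "real n * ?z (Suc n) \<le> 2 * ?x * ?z n" for n
  proof -
    have "real n * ?z (Suc n) = q (sc (of_nat n) (\<phi> (mono 0 (Suc n))))"
      by (simp add: seminorm_sc[OF q])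
    also have "\<dots> \<le> q (\<phi> (mono 0 n) * \<phi> (mono 1 0)) + q (\<phi> (mono 1 0) * \<phi> (mono 0 n))"
      unfolding phi_commutator by (rule seminorm_diff[OF q])
    also have "\<dots> \<le> ?z n * ?x + ?x * ?z n"
      by (intro add_mono seminorm_mult[OF q])
    finally show ?thesis by (simp add: mult_ac)
  qed
  \<comment> \<open>The induction starts at exponent 1, because \<open>step\<close> with
    \<open>n = 0\<close> gives no control of \<open>?z 1\<close>.\<close>
  have Suc_bound: "?z (Suc n) * fact (Suc n) \<le> K * \<rho> ^ Suc n" for n
  proof (induction n)
    case 0
    have "?z 1 \<le> K * 1" using nn[of 1] by (simp add: K_def)
    also have "\<dots> \<le> K * \<rho>" using K \<rho> by (intro mult_left_mono) auto
    finally show ?case by simp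
  next
    case (Suc n)
    let ?m = "Suc n"
    \<comment> \<open>Here \<open>?m \<ge> 1\<close>, so the factor \<open>?m + 1\<close> needed for
      the factorial costs at most twice the factor \<open>?m\<close> supplied by
      \<open>step\<close>.\<close>
    have "real (Suc ?m) * ?z (Suc ?m) \<le> (2 * real ?m) * ?z (Suc ?m)"
      using nn by (intro mult_right_mono) auto
    also have "\<dots> = 2 * (real ?m * ?z (Suc ?m))" by simp
    also have "\<dots> \<le> 2 * (2 * ?x * ?z ?m)" by (intro mult_left_mono step) simp
    also have "\<dots> = 4 * ?x * ?z ?m" by simp
    also have "\<dots> \<le> \<rho> * ?z ?m" using \<rho> nn by (intro mult_right_mono) auto
    finally have "real (Suc ?m) * ?z (Suc ?m) * fact ?m \<le> \<rho> * ?z ?m * fact ?m"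
      by (intro mult_right_mono) auto
    also have "\<dots> = \<rho> * (?z ?m * fact ?m)" by simp
    also have "\<dots> \<le> \<rho> * (K * \<rho> ^ ?m)" using Suc \<rho> by (intro mult_left_mono) auto
    finally show ?case by (simp add: fact_Suc[of ?m] mult_ac del: fact_Suc)
  qed
  have z: "?z n * fact n \<le> K * \<rho> ^ n" for n
    using Suc_bound[of "n - 1"] nn by (cases n) (auto simp: K_def phi_one)
  have "q (\<phi> (mono i j)) \<le> \<rho> ^ i * ?z j" for i j
  proof (induction i)
    case (Suc i)
    have "q (\<phi> (mono (Suc i) j)) \<le> ?x * q (\<phi> (mono i j))"
      unfolding phi_mono_Suc by (rule seminorm_mult[OF q])
    also have "\<dots> \<le> \<rho> * (\<rho> ^ i * ?z j)" using Suc \<rho> nn by (intro mult_mono) auto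
    finally show ?case by (simp add: mult_ac)
  qed simp
  moreover have "\<rho> ^ i * ?z j \<le> K * (\<rho> ^ (i + j) / fact j)" for i j
  proof -
    have "?z j \<le> K * \<rho> ^ j / fact j" using z[of j] by (simp add: pos_le_divide_eq)
    then have "\<rho> ^ i * ?z j \<le> \<rho> ^ i * (K * \<rho> ^ j / fact j)"
      using \<rho> by (intro mult_left_mono) auto
    then show ?thesis by (simp add: power_add mult_ac)
  qed
  ultimately have "q (\<phi> (mono i j)) \<le> K * (\<rho> ^ (i + j) / fact j)" for i j
    using order_trans by blast
  with \<rho> K show thesis by (intro that[of \<rho> K]) auto
qed

text \<open>The bound on monomials is \<open>K\<close> times the weight in
  \<open>rnorm \<rho>\<close>, so the triangle inequality over the finite expansion of
  \<open>f\<close> sums to the norm.\<close>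

lemma phi_bound:
  assumes q: "q \<in> N"
  obtains \<rho> K where "0 < \<rho>" "0 \<le> K" "\<And>f. finsupp f \<Longrightarrow> q (\<phi> f) \<le> K * rnorm \<rho> f"
proof -
  obtain \<rho> K where \<rho>: "0 < \<rho>" and K: "0 \<le> K"
    and m: "\<And>i j. q (\<phi> (mono i j)) \<le> K * (\<rho> ^ (i + j) / fact j)"
    using phi_mono_bound[OF q] by blast
  have "q (\<phi> f) \<le> K * rnorm \<rho> f" if f: "finsupp f" for f
  proof -
    let ?S = "{p. f p \<noteq> 0}"
    have fin: "finite ?S" using f by (simp add: finsupp_def)
    have q_sum: "q (sum g S) \<le> (\<Sum>s\<in>S. q (g s))" if "finite S" for g and S :: "(nat \<times> nat) set"
      using that
      by induction (auto simp: seminorm_zero[OF q] intro: order_trans[OF seminorm_add[OF q]])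
    have "f = (\<lambda>p. if p \<in> ?S then f p else 0)" by auto
    then have "q (\<phi> f) = q (\<Sum>r\<in>?S. sc (f r) (\<phi> (mono (fst r) (snd r))))"
      using phi_sum[OF fin, of f] by simp
    also have "\<dots> \<le> (\<Sum>r\<in>?S. norm (f r) * q (\<phi> (mono (fst r) (snd r))))"
      using q_sum[OF fin] by (simp add: seminorm_sc[OF q, symmetric])
    also have "\<dots> \<le> (\<Sum>r\<in>?S. norm (f r) * (K * (\<rho> ^ (fst r + snd r) / fact (snd r))))"
      by (intro sum_mono mult_left_mono m) auto
    also have "\<dots> = K * sum (rterm \<rho> f) ?S"
      unfolding sum_distrib_left by (rule sum.cong) (auto simp: rterm_def)
    also have "\<dots> \<le> K * rnorm \<rho> f"
      using K \<rho> fin f by (intro mult_left_mono sum_rterm_le_rnorm summable_rterm_finsupp) auto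
    finally show ?thesis .
  qed
  with \<rho> K show thesis by (intro that[of \<rho> K])
qed

section \<open>Sequential convergence in the target algebra\<close>

definition bconv :: "(nat \<Rightarrow> 'b) \<Rightarrow> 'b \<Rightarrow> bool" where
  "bconv s L \<longleftrightarrow> (\<forall>q\<in>N. (\<lambda>n. q (s n - L)) \<longlonglongrightarrow> 0)"

lemma bconvI: "(\<And>q. q \<in> N \<Longrightarrow> (\<lambda>n. q (s n - L)) \<longlonglongrightarrow> 0) \<Longrightarrow> bconv s L"
  and bconvD: "bconv s L \<Longrightarrow> q \<in> N \<Longrightarrow> (\<lambda>n. q (s n - L)) \<longlonglongrightarrow> 0"
  by (auto simp: bconv_def)

text \<open>This is the Hausdorff condition: some seminorm in \<open>N\<close> separates distinct
  elements.\<close>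

lemma bconv_unique:
  assumes "bconv s L" "bconv s L'"
  shows "L = L'"
proof (rule ccontr)
  assume "L \<noteq> L'"
  then obtain q where q: "q \<in> N" and ne: "q (L - L') \<noteq> 0"
    using AM unfolding AM_algebra_def by (metis right_minus_eq)
  have "(\<lambda>n. q (L - L')) \<longlonglongrightarrow> 0"
  proof (rule null_sequence_le)
    show "(\<lambda>n. q (s n - L') + q (s n - L)) \<longlonglongrightarrow> 0"
      using tendsto_add[OF bconvD[OF assms(2) q] bconvD[OF assms(1) q]] by simp
    show "q (L - L') \<le> q (s n - L') + q (s n - L)" for n
      using seminorm_diff[OF q, of "s n - L'" "s n - L"] by simp
  qed (simp add: seminorm_nonneg[OF q])
  with ne show False by (simp add: LIMSEQ_const_iff)
qed

lemma bconv_add: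
  assumes "bconv s K" "bconv t L"
  shows "bconv (\<lambda>n. s n + t n) (K + L)"
proof (rule bconvI)
  fix q assume q: "q \<in> N"
  show "(\<lambda>n. q (s n + t n - (K + L))) \<longlonglongrightarrow> 0"
  proof (rule null_sequence_le)
    show "(\<lambda>n. q (s n - K) + q (t n - L)) \<longlonglongrightarrow> 0"
      using tendsto_add[OF bconvD[OF assms(1) q] bconvD[OF assms(2) q]] by simp
    show "q (s n + t n - (K + L)) \<le> q (s n - K) + q (t n - L)" for n
      using seminorm_add[OF q, of "s n - K" "t n - L"] by (simp add: algebra_simps)
  qed (simp add: seminorm_nonneg[OF q])
qed

lemma bconv_sc:
  assumes "bconv s L"
  shows "bconv (\<lambda>n. sc c (s n)) (sc c L)"
proof (rule bconvI)
  fix q assume q: "q \<in> N"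
  show "(\<lambda>n. q (sc c (s n) - sc c L)) \<longlonglongrightarrow> 0"
    unfolding sc_diff[symmetric] seminorm_sc[OF q]
    by (intro tendsto_mult_right_zero bconvD[OF assms q])
qed

lemma bconv_mult:
  assumes "bconv s K" "bconv t L"
  shows "bconv (\<lambda>n. s n * t n) (K * L)"
proof (rule bconvI)
  fix q assume q: "q \<in> N"
  show "(\<lambda>n. q (s n * t n - K * L)) \<longlonglongrightarrow> 0"
  proof (rule null_sequence_le)
    have "(\<lambda>n. q (s n - K) * (q (t n - L) + q L) + q K * q (t n - L)) \<longlonglongrightarrow> 0 * (0 + q L) + q K * 0"
      by (intro tendsto_intros bconvD[OF assms(1) q] bconvD[OF assms(2) q])
    then show "(\<lambda>n. q (s n - K) * (q (t n - L) + q L) + q K * q (t n - L)) \<longlonglongrightarrow> 0" by simp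
    fix n
    have "s n * t n - K * L = (s n - K) * t n + K * (t n - L)" by (simp add: algebra_simps)
    then have "q (s n * t n - K * L) \<le> q ((s n - K) * t n) + q (K * (t n - L))"
      using seminorm_add[OF q] by simp
    also have "\<dots> \<le> q (s n - K) * q (t n) + q K * q (t n - L)"
      by (intro add_mono seminorm_mult[OF q])
    also have "q (t n) \<le> q (t n - L) + q L" using seminorm_add[OF q, of "t n - L" L] by simp
    finally show "q (s n * t n - K * L) \<le> q (s n - K) * (q (t n - L) + q L) + q K * q (t n - L)"
      using seminorm_nonneg[OF q] by (simp add: mult_left_mono)
  qed (simp add: seminorm_nonneg[OF q])
qed

text \<open>Completeness is stated for Cauchy filters; a Cauchy sequence enters through its image
  filter, with tail images as the small sets.\<close>

lemma bconv_exists: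
  assumes "\<And>q \<epsilon>. q \<in> N \<Longrightarrow> 0 < \<epsilon> \<Longrightarrow> \<exists>M. \<forall>m\<ge>M. \<forall>n\<ge>M. q (s m - s n) < \<epsilon>"
  shows "\<exists>L. bconv s L"
proof -
  let ?F = "filtermap s sequentially"
  have "\<forall>\<^sub>F (a, b) in ?F \<times>\<^sub>F ?F. q (a - b) < \<epsilon>" if "q \<in> N" "0 < \<epsilon>" for q \<epsilon>
  proof -
    obtain M where M: "\<forall>m\<ge>M. \<forall>n\<ge>M. q (s m - s n) < \<epsilon>"
      using assms[OF \<open>q \<in> N\<close> \<open>0 < \<epsilon>\<close>] by blast
    have "eventually (\<lambda>a. a \<in> s ` {M..}) ?F"
      by (auto simp: eventually_filtermap eventually_sequentially)
    then show ?thesis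
      unfolding eventually_prod_filter using M
      by (intro exI[of _ "\<lambda>a. a \<in> s ` {M..}"]) auto
  qed
  moreover have "?F \<noteq> bot" by (simp add: filtermap_bot_iff)
  ultimately obtain L where L: "\<forall>q\<in>N. \<forall>\<epsilon>>0. \<forall>\<^sub>F a in ?F. q (a - L) < \<epsilon>"
    using AM unfolding AM_algebra_def by blast
  have "bconv s L"
  proof (rule bconvI, rule LIMSEQ_I)
    fix q and r :: real assume "q \<in> N" "0 < r"
    then show "\<exists>no. \<forall>n\<ge>no. norm (q (s n - L) - 0) < r"
      using L by (auto simp: eventually_filtermap eventually_sequentially seminorm_nonneg)
  qed
  then show ?thesis ..
qed

section \<open>Extension by density to the completion\<close>

definition ext :: "coef \<Rightarrow> 'b" where
  "ext a = (SOME L. bconv (\<lambda>n. \<phi> (trunc n a)) L)"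

text \<open>The truncations are Cauchy in every \<open>rnorm \<rho>\<close>, and
  \<open>phi_bound\<close> carries this to each seminorm. Thus the choice in \<open>ext\<close>
  picks an actual limit.\<close>

lemma bconv_ext_trunc:
  assumes a: "a \<in> Ehat"
  shows "bconv (\<lambda>n. \<phi> (trunc n a)) (ext a)"
proof -
  have "\<exists>L. bconv (\<lambda>n. \<phi> (trunc n a)) L"
  proof (rule bconv_exists)
    fix q and \<epsilon> :: real assume q: "q \<in> N" and \<epsilon>: "0 < \<epsilon>"
    obtain \<rho> K where \<rho>: "0 < \<rho>" and K: "0 \<le> K" and b: "\<And>f. finsupp f \<Longrightarrow> q (\<phi> f) \<le> K * rnorm \<rho> f"
      using phi_bound[OF q] by blast
    define v where "v n = K * rnorm \<rho> (cdiff (trunc n a) a)" for n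
    have "v \<longlonglongrightarrow> 0"
      unfolding v_def by (intro tendsto_mult_right_zero econvD[OF econv_trunc[OF a] \<rho>])
    then obtain M where M: "\<And>n. n \<ge> M \<Longrightarrow> v n < \<epsilon> / 2"
      using \<epsilon> order_tendstoD(2)[of v 0 sequentially "\<epsilon> / 2"] by (auto simp: eventually_sequentially)
    have "q (\<phi> (trunc m a) - \<phi> (trunc n a)) < \<epsilon>" if "m \<ge> M" "n \<ge> M" for m n
    proof -
      have "q (\<phi> (trunc m a) - \<phi> (trunc n a)) \<le> K * rnorm \<rho> (cdiff (trunc m a) (trunc n a))"
        using b[of "cdiff (trunc m a) (trunc n a)"] by (simp add: phi_cdiff finsupp_cdiff)
      also have "\<dots> \<le> K * (rnorm \<rho> (cdiff (trunc m a) a) + rnorm \<rho> (cdiff (trunc n a) a))"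
        using K \<rho> a by (intro mult_left_mono rnorm_cdiff_triangle) (auto intro: Ehat_finsupp)
      also have "\<dots> = v m + v n" by (simp add: v_def distrib_left)
      also have "\<dots> < \<epsilon>" using M[OF that(1)] M[OF that(2)] by simp
      finally show ?thesis .
    qed
    then show "\<exists>M. \<forall>m\<ge>M. \<forall>n\<ge>M. q (\<phi> (trunc m a) - \<phi> (trunc n a)) < \<epsilon>" by blast
  qed
  then show ?thesis unfolding ext_def by (rule someI_ex)
qed

text \<open>Any finitely supported approximation computes \<open>ext a\<close>: by
  \<open>phi_bound\<close> its image differs from that of the truncations by a null sequence. This
  permits approximations such as products of truncations.\<close>

lemma bconv_ext:
  assumes a: "a \<in> Ehat" and s: "\<And>n. finsupp (s n)" "econv s a"
  shows "bconv (\<lambda>n. \<phi> (s n)) (ext a)"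
proof (rule bconvI)
  fix q assume q: "q \<in> N"
  obtain \<rho> K where \<rho>: "0 < \<rho>" and K: "0 \<le> K" and b: "\<And>f. finsupp f \<Longrightarrow> q (\<phi> f) \<le> K * rnorm \<rho> f"
    using phi_bound[OF q] by blast
  let ?u = "\<lambda>n. rnorm \<rho> (cdiff (s n) a)" and ?v = "\<lambda>n. rnorm \<rho> (cdiff (trunc n a) a)"
    and ?w = "\<lambda>n. q (\<phi> (trunc n a) - ext a)"
  show "(\<lambda>n. q (\<phi> (s n) - ext a)) \<longlonglongrightarrow> 0"
  proof (rule null_sequence_le)
    have "(\<lambda>n. K * (?u n + ?v n) + ?w n) \<longlonglongrightarrow> K * (0 + 0) + 0"
      by (intro tendsto_intros econvD[OF s(2) \<rho>] econvD[OF econv_trunc[OF a] \<rho>]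
          bconvD[OF bconv_ext_trunc[OF a] q])
    then show "(\<lambda>n. K * (?u n + ?v n) + ?w n) \<longlonglongrightarrow> 0" by simp
    fix n
    have "q (\<phi> (s n) - ext a) \<le> q (\<phi> (s n) - \<phi> (trunc n a)) + ?w n"
      using seminorm_add[OF q, of "\<phi> (s n) - \<phi> (trunc n a)" "\<phi> (trunc n a) - ext a"] by simp
    also have "q (\<phi> (s n) - \<phi> (trunc n a)) \<le> K * rnorm \<rho> (cdiff (s n) (trunc n a))"
      using b[of "cdiff (s n) (trunc n a)"] s(1) by (simp add: phi_cdiff finsupp_cdiff)
    also have "\<dots> \<le> K * (?u n + ?v n)"
      using K \<rho> a s(1) by (intro mult_left_mono rnorm_cdiff_triangle) (auto intro: Ehat_finsupp)
    finally show "q (\<phi> (s n) - ext a) \<le> K * (?u n + ?v n) + ?w n" by simp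
  qed (simp add: seminorm_nonneg[OF q])
qed

lemma ext_finsupp: "finsupp f \<Longrightarrow> ext f = \<phi> f"
  by (rule bconv_unique[OF bconv_ext[OF Ehat_finsupp _ econv_const]])
    (auto simp: bconv_def seminorm_zero)

text \<open>Each algebraic identity compares two limits of one sequence: one from
  \<open>bconv_ext\<close>, the other from continuity of the operations in the target.\<close>

lemma ext_hom: "ehat_hom sc N ext"
  unfolding ehat_hom_def
proof (intro conjI ballI allI)
  fix a b assume ab: "a \<in> Ehat" "b \<in> Ehat"
  note tr = Ehat_finsupp[OF finsupp_trunc]
  show "ext (cadd a b) = ext a + ext b"
  proof (rule bconv_unique)
    show "bconv (\<lambda>n. \<phi> (cadd (trunc n a) (trunc n b))) (ext (cadd a b))"
      using ab tr by (intro bconv_ext econv_cadd econv_trunc Ehat_cadd) auto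
    show "bconv (\<lambda>n. \<phi> (cadd (trunc n a) (trunc n b))) (ext a + ext b)"
      using ab by (simp add: phi_cadd bconv_add bconv_ext_trunc)
  qed
  have fin: "finsupp (jmult (trunc n a) (trunc n b))" for n
    by (simp add: finsupp_jmult)
  show "ext (emult a b) = ext a * ext b"
  proof (rule bconv_unique)
    have "econv (\<lambda>n. jmult (trunc n a) (trunc n b)) (emult a b)"
      unfolding emult_eq_jmult[OF finsupp_trunc, symmetric]
      using ab tr by (intro econv_emult econv_trunc) auto
    then show "bconv (\<lambda>n. \<phi> (jmult (trunc n a) (trunc n b))) (ext (emult a b))"
      using ab fin by (intro bconv_ext Ehat_emult)
    show "bconv (\<lambda>n. \<phi> (jmult (trunc n a) (trunc n b))) (ext a * ext b)"
      using ab by (simp add: phi_jmult bconv_mult bconv_ext_trunc)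
  qed
next
  fix c a assume a: "a \<in> Ehat"
  show "ext (cscale c a) = sc c (ext a)"
  proof (rule bconv_unique)
    show "bconv (\<lambda>n. \<phi> (cscale c (trunc n a))) (ext (cscale c a))"
      using a by (intro bconv_ext econv_cscale econv_trunc Ehat_cscale) auto
    show "bconv (\<lambda>n. \<phi> (cscale c (trunc n a))) (sc c (ext a))"
      using a by (simp add: phi_cscale bconv_sc bconv_ext_trunc)
  qed
next
  show "ext (mono 0 0) = 1" by (simp add: ext_finsupp phi_one)
next
  fix q assume q: "q \<in> N"
  obtain \<rho> K where \<rho>: "0 < \<rho>" and K: "0 \<le> K" and b: "\<And>f. finsupp f \<Longrightarrow> q (\<phi> f) \<le> K * rnorm \<rho> f"
    using phi_bound[OF q] by blast
  \<comment> \<open>The constants of \<open>phi_bound\<close> survive the limit because truncation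
    does not increase the norm.\<close>
  have "q (ext a) \<le> K * rnorm \<rho> a" if a: "a \<in> Ehat" for a
  proof (rule LIMSEQ_le_const)
    let ?w = "\<lambda>n. q (\<phi> (trunc n a) - ext a)"
    have "(\<lambda>n. K * rnorm \<rho> a + ?w n) \<longlonglongrightarrow> K * rnorm \<rho> a + 0"
      by (intro tendsto_intros bconvD[OF bconv_ext_trunc[OF a] q])
    then show "(\<lambda>n. K * rnorm \<rho> a + ?w n) \<longlonglongrightarrow> K * rnorm \<rho> a" by simp
    have "q (ext a) \<le> K * rnorm \<rho> a + ?w n" for n
    proof -
      have "q (ext a) \<le> q (\<phi> (trunc n a)) + ?w n"
        using seminorm_diff[OF q, of "\<phi> (trunc n a)" "\<phi> (trunc n a) - ext a"] by simp
      also have "q (\<phi> (trunc n a)) \<le> K * rnorm \<rho> (trunc n a)" by (rule b) simp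
      also have "\<dots> \<le> K * rnorm \<rho> a" using K rnorm_trunc_le[OF a \<rho>] by (intro mult_left_mono)
      finally show ?thesis by simp
    qed
    then show "\<exists>M. \<forall>n\<ge>M. q (ext a) \<le> K * rnorm \<rho> a + ?w n" by blast
  qed
  with \<rho> show "\<exists>\<rho>>0. \<exists>C. \<forall>a\<in>Ehat. q (ext a) \<le> C * rnorm \<rho> a" by blast
qed

text \<open>By continuity \<open>\<psi> a\<close> is also a limit of the images of the truncations,
  on which both maps equal \<open>\<phi>\<close>.\<close>

lemma ext_unique:
  assumes hom': "ehat_hom sc N \<psi>" and eq: "\<And>f. finsupp f \<Longrightarrow> \<psi> f = \<phi> f" and a: "a \<in> Ehat"
  shows "\<psi> a = ext a"
proof (rule bconv_unique[OF _ bconv_ext_trunc[OF a]], rule bconvI)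
  fix q assume q: "q \<in> N"
  then obtain \<rho> C where \<rho>: "0 < \<rho>" and C: "\<And>a. a \<in> Ehat \<Longrightarrow> q (\<psi> a) \<le> C * rnorm \<rho> a"
    using hom' unfolding ehat_hom_def by blast
  have tr: "trunc n a \<in> Ehat" for n by (simp add: Ehat_finsupp)
  have diff: "\<psi> (cdiff (trunc n a) a) = \<phi> (trunc n a) - \<psi> a" for n
    using hom' a tr[of n] by (simp add: ehat_hom_def cdiff_def Ehat_cscale eq sc_minus_one)
  show "(\<lambda>n. q (\<phi> (trunc n a) - \<psi> a)) \<longlonglongrightarrow> 0"
  proof (rule null_sequence_le)
    show "(\<lambda>n. C * rnorm \<rho> (cdiff (trunc n a) a)) \<longlonglongrightarrow> 0"
      by (intro tendsto_mult_right_zero econvD[OF econv_trunc[OF a] \<rho>])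
    show "q (\<phi> (trunc n a) - \<psi> a) \<le> C * rnorm \<rho> (cdiff (trunc n a) a)" for n
      using C[OF Ehat_cdiff[OF tr[of n] a]] by (simp add: diff)
  qed (simp add: seminorm_nonneg[OF q])
qed

end

section \<open>The completed algebra and its universal property\<close>

theorem mainTheorem3:
  shows "Ehat_is_AM_algebra
    \<and> (\<forall>f g. finsupp f \<and> finsupp g \<longrightarrow> f \<in> Ehat \<and> emult f g = jmult f g)
    \<and> (\<forall>(sc :: complex \<Rightarrow> 'b::ring_1 \<Rightarrow> 'b) N. AM_algebra sc N \<longrightarrow>
        (\<forall>\<phi>. lam_hom sc \<phi> \<longrightarrow>
          (\<exists>\<psi>. ehat_hom sc N \<psi> \<and> (\<forall>f. finsupp f \<longrightarrow> \<psi> f = \<phi> f)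
             \<and> (\<forall>\<psi>'. ehat_hom sc N \<psi>' \<and> (\<forall>f. finsupp f \<longrightarrow> \<psi>' f = \<phi> f)
                    \<longrightarrow> (\<forall>a\<in>Ehat. \<psi>' a = \<psi> a)))))"
proof (intro conjI allI impI)
  show Ehat_is_AM_algebra by (rule Ehat_is_AM_algebra)
next
  fix f g assume "finsupp f \<and> finsupp g"
  then show "f \<in> Ehat" "emult f g = jmult f g" by (simp_all add: Ehat_finsupp emult_eq_jmult)
next
  fix sc :: "complex \<Rightarrow> 'b \<Rightarrow> 'b" and N \<phi>
  assume "AM_algebra sc N" "lam_hom sc \<phi>"
  then interpret AM_hom sc N \<phi> by unfold_locales
  show "\<exists>\<psi>. ehat_hom sc N \<psi> \<and> (\<forall>f. finsupp f \<longrightarrow> \<psi> f = \<phi> f)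
             \<and> (\<forall>\<psi>'. ehat_hom sc N \<psi>' \<and> (\<forall>f. finsupp f \<longrightarrow> \<psi>' f = \<phi> f)
                    \<longrightarrow> (\<forall>a\<in>Ehat. \<psi>' a = \<psi> a))"
    using ext_hom ext_finsupp ext_unique by blast
qed

end
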